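(* Let $G=(A,B,E)$ be a bipartite graph with $n=|A|$, where $|B|$ is bounded by a polynomial in $n$, and whose edges arrive as a stream in arbitrary order. There is a $\log(n)$-pass streaming algorithm using space $\tilde{\mathrm{O}}(n)$ that computes a $4\log(n)$-approximation to the semi-matching problem, i.e. it outputs a semi-matching $S$ of $G$ with $\operatorname{deg}_{\max} S\le 4\log(n)\cdot\operatorname{deg}_{\max} S^*$, where $S^*$ is an optimal semi-matching of $G$.
   Context: For $E'\subseteq E$ and a vertex $v$, $\deg_{E'}(v)$ is the number of edges of $E'$ incident to $v$, and $\operatorname{deg}_{\max} E'=\max_{v\in A\cup B}\deg_{E'}(v)$. A semi-matching of $G$ is a set $S\subseteq E$ with $\deg_S(a)=1$ for all $a\in A$ (it is assumed that $G$ has one). A degree-minimizing path with respect to a semi-matching $S$ is a path $b_1,a_1,b_2,\dots,a_{k-1},b_k$ ($k\ge2$) with $(a_i,b_i)\in S$, $(a_i,b_{i+1})\in E\setminus S$, and $\deg_S(b_1)\ge\deg_S(b_k)+2$. An optimal semi-matching is a semi-matching admitting no degree-minimizing path; all optimal semi-matchings have the same (minimum possible) maximum degree. $\tilde{\mathrm{O}}(f)$ means $\mathrm{O}(f\cdot\mathrm{polylog}\,n)$; $\log$ is base 2. *)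

theory Defs
  imports Complex_Main "HOL-Computational_Algebra.Polynomial"
begin

definition bipartite_graph :: "'v set \<Rightarrow> 'v set \<Rightarrow> ('v \<times> 'v) set \<Rightarrow> bool" where
  "bipartite_graph A B E \<longleftrightarrow> finite A \<and> finite B \<and> A \<inter> B = {} \<and> E \<subseteq> A \<times> B"

definition deg :: "('v \<times> 'v) set \<Rightarrow> 'v \<Rightarrow> nat" where
  "deg F v = card {e \<in> F. fst e = v \<or> snd e = v}"

definition deg_max :: "'v set \<Rightarrow> 'v set \<Rightarrow> ('v \<times> 'v) set \<Rightarrow> nat" where
  "deg_max A B F = Max (deg F ` (A \<union> B))"

definition semi_matching :: "'v set \<Rightarrow> ('v \<times> 'v) set \<Rightarrow> ('v \<times> 'v) set \<Rightarrow> bool" where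
  "semi_matching A E S \<longleftrightarrow> S \<subseteq> E \<and> (\<forall>a\<in>A. deg S a = 1)"

text \<open>The path \<open>b\<^sub>1, a\<^sub>1, b\<^sub>2, \<dots>, a\<^sub>k\<^sub>-\<^sub>1, b\<^sub>k\<close> is given by the list \<open>bs\<close> of its \<open>k\<close> vertices
  in \<open>B\<close> and the list \<open>as\<close> of its \<open>k - 1\<close> vertices in \<open>A\<close>.\<close>

definition degree_minimizing_path ::
    "('v \<times> 'v) set \<Rightarrow> ('v \<times> 'v) set \<Rightarrow> 'v list \<Rightarrow> 'v list \<Rightarrow> bool" where
  "degree_minimizing_path E S bs as \<longleftrightarrow>
     length bs \<ge> 2 \<and> length bs = length as + 1 \<and> distinct (bs @ as) \<and>
     (\<forall>i < length as. (as ! i, bs ! i) \<in> S \<and> (as ! i, bs ! (i + 1)) \<in> E - S) \<and>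
     deg S (hd bs) \<ge> deg S (last bs) + 2"

definition optimal_semi_matching :: "'v set \<Rightarrow> ('v \<times> 'v) set \<Rightarrow> ('v \<times> 'v) set \<Rightarrow> bool" where
  "optimal_semi_matching A E S \<longleftrightarrow>
     semi_matching A E S \<and> (\<nexists>bs as. degree_minimizing_path E S bs as)"

text \<open>Streaming algorithms are deterministic random access machine programs. The memory consists
  of \<open>N\<close> cells of \<open>w\<close> bits each, i.e. of \<open>N * w\<close> bits. Neither \<open>N\<close> nor \<open>w\<close> can be observed by the
  program: they only bound the resources, and an execution that exceeds them has no derivation
  in the semantics. Output goes to a write-only medium, which is not part of the memory.\<close>

datatype expr =
    Const nat
  | Cell expr
  | Add expr expr
  | Sub expr expr
  | Mul expr expr
  | Div expr expr

datatype com =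
    Skip
  | Store expr expr
  | Emit expr expr
  | Seq com com
  | Cond expr com com
  | While expr com

type_synonym memory = "nat \<Rightarrow> nat"
type_synonym edge_output = "(nat \<times> nat) set"

fun val :: "memory \<Rightarrow> expr \<Rightarrow> nat" where
  "val s (Const c) = c"
| "val s (Cell e) = s (val s e)"
| "val s (Add e f) = val s e + val s f"
| "val s (Sub e f) = val s e - val s f"
| "val s (Mul e f) = val s e * val s f"
| "val s (Div e f) = val s e div val s f"

text \<open>Intermediate values have to fit into a word as well, and only existing cells are read.\<close>

fun fits :: "nat \<Rightarrow> nat \<Rightarrow> memory \<Rightarrow> expr \<Rightarrow> bool" where
  "fits N w s (Const c) \<longleftrightarrow> c < 2 ^ w"
| "fits N w s (Cell e) \<longleftrightarrow> fits N w s e \<and> val s e < N \<and> val s (Cell e) < 2 ^ w"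
| "fits N w s (Add e f) \<longleftrightarrow> fits N w s e \<and> fits N w s f \<and> val s (Add e f) < 2 ^ w"
| "fits N w s (Sub e f) \<longleftrightarrow> fits N w s e \<and> fits N w s f \<and> val s (Sub e f) < 2 ^ w"
| "fits N w s (Mul e f) \<longleftrightarrow> fits N w s e \<and> fits N w s f \<and> val s (Mul e f) < 2 ^ w"
| "fits N w s (Div e f) \<longleftrightarrow> fits N w s e \<and> fits N w s f \<and> val s (Div e f) < 2 ^ w"

inductive exec :: "nat \<Rightarrow> nat \<Rightarrow> com \<Rightarrow> memory \<times> edge_output \<Rightarrow> memory \<times> edge_output \<Rightarrow> bool"
  for N w :: nat where
  Skip: "exec N w Skip st st"
| Store: "\<lbrakk>fits N w s e; fits N w s f; val s e < N\<rbrakk>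
    \<Longrightarrow> exec N w (Store e f) (s, out) (s(val s e := val s f), out)"
| Emit: "\<lbrakk>fits N w s e; fits N w s f\<rbrakk>
    \<Longrightarrow> exec N w (Emit e f) (s, out) (s, insert (val s e, val s f) out)"
| Seq: "\<lbrakk>exec N w c st st'; exec N w d st' st''\<rbrakk> \<Longrightarrow> exec N w (Seq c d) st st''"
| CondTrue: "\<lbrakk>fits N w s e; val s e \<noteq> 0; exec N w c (s, out) st'\<rbrakk>
    \<Longrightarrow> exec N w (Cond e c d) (s, out) st'"
| CondFalse: "\<lbrakk>fits N w s e; val s e = 0; exec N w d (s, out) st'\<rbrakk>
    \<Longrightarrow> exec N w (Cond e c d) (s, out) st'"
| WhileTrue: "\<lbrakk>fits N w s e; val s e \<noteq> 0; exec N w c (s, out) st'; exec N w (While e c) st' st''\<rbrakk>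
    \<Longrightarrow> exec N w (While e c) (s, out) st''"
| WhileFalse: "\<lbrakk>fits N w s e; val s e = 0\<rbrakk> \<Longrightarrow> exec N w (While e c) (s, out) (s, out)"

record stream_alg =
  init :: com         \<comment> \<open>run once, before the first pass\<close>
  begin_pass :: com   \<comment> \<open>run at the beginning of every pass\<close>
  edge :: com         \<comment> \<open>run for every edge of every pass\<close>
  finish :: com       \<comment> \<open>run once, after the last pass\<close>

text \<open>The endpoints of the current edge are placed in cells 1 and 2.\<close>

inductive feed ::
    "nat \<Rightarrow> nat \<Rightarrow> com \<Rightarrow> (nat \<times> nat) list \<Rightarrow> memory \<times> edge_output \<Rightarrow> memory \<times> edge_output \<Rightarrow> bool"
  for N w :: nat and c :: com where
  Nil: "feed N w c [] st st"
| Cons: "\<lbrakk>2 < N; u < 2 ^ w; v < 2 ^ w; exec N w c (s(1 := u, 2 := v), out) st';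
     feed N w c es st' st''\<rbrakk> \<Longrightarrow> feed N w c ((u, v) # es) (s, out) st''"

inductive passes ::
    "nat \<Rightarrow> nat \<Rightarrow> stream_alg \<Rightarrow> (nat \<times> nat) list \<Rightarrow> nat \<Rightarrow>
     memory \<times> edge_output \<Rightarrow> memory \<times> edge_output \<Rightarrow> bool"
  for N w :: nat and P :: stream_alg and es :: "(nat \<times> nat) list" where
  Zero: "passes N w P es 0 st st"
| Suc: "\<lbrakk>exec N w (begin_pass P) st st1; feed N w (edge P) es st1 st2; passes N w P es p st2 st3\<rbrakk>
    \<Longrightarrow> passes N w P es (Suc p) st st3"

text \<open>\<open>streaming_run N w P p n es out\<close>: within \<open>N\<close> cells of \<open>w\<close> bits, the algorithm \<open>P\<close> makes
  \<open>p\<close> passes over the stream \<open>es\<close>, halts and has output exactly the edges \<open>out\<close>. It knows only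
  the parameter \<open>n\<close> in advance, which is initially stored in cell 0; all other cells hold 0.\<close>

definition streaming_run ::
    "nat \<Rightarrow> nat \<Rightarrow> stream_alg \<Rightarrow> nat \<Rightarrow> nat \<Rightarrow> (nat \<times> nat) list \<Rightarrow> edge_output \<Rightarrow> bool" where
  "streaming_run N w P p n es out \<longleftrightarrow>
     0 < N \<and> n < 2 ^ w \<and>
     (\<exists>st1 st2 s. exec N w (init P) ((\<lambda>_. 0)(0 := n), {}) st1 \<and>
        passes N w P es p st1 st2 \<and> exec N w (finish P) st2 (s, out))"

text \<open>The machine refers to vertices by numbers: \<open>0, \<dots>, |A| - 1\<close> for the vertices in \<open>A\<close> and
  \<open>|A|, \<dots>, |A| + |B| - 1\<close> for those in \<open>B\<close>, in arbitrary order.\<close>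

definition numbering :: "'v set \<Rightarrow> 'v set \<Rightarrow> ('v \<Rightarrow> nat) \<Rightarrow> bool" where
  "numbering A B num \<longleftrightarrow>
     bij_betw num A {..<card A} \<and> bij_betw num B {card A..<card A + card B}"

end

theory Submission
  imports Defs
begin

text \<open>For every capacity \<open>\<kappa> = 2 ^ i < 2 * n\<close> in parallel, each pass greedily matches every still
  unmatched vertex of \<open>A\<close> to a neighbour that has received fewer than \<open>\<kappa>\<close> vertices in this pass. If
  \<open>d\<close> is the maximum degree of some semi-matching \<open>S'\<close> and \<open>\<kappa> \<ge> 2 * d\<close>, then the \<open>u\<close> vertices left
  unmatched by a pass have saturated \<open>S'\<close>-partners, of which there are at least \<open>u / d\<close>; so the pass has
  matched at least \<open>2 * u\<close> vertices, and the number of unmatched vertices drops to a third. Hence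
  \<open>L = \<lfloor>log n\<rfloor>\<close> passes match all of \<open>A\<close>. The least capacity that succeeds is below \<open>4 * d\<close>, and the
  degrees it yields are at most \<open>L * \<kappa>\<close>.\<close>

section \<open>Greedy passes with bounded capacity\<close>

text \<open>A partial assignment \<open>f\<close> maps \<open>j < n\<close> to \<open>b * n + p\<close> if \<open>j\<close> was matched to \<open>b\<close> in pass \<open>p\<close>,
  where \<open>1 \<le> p < n\<close>, and to \<open>0\<close> if \<open>j\<close> is unmatched.\<close>

definition greedy_step :: "nat \<Rightarrow> nat \<Rightarrow> nat \<Rightarrow> nat \<times> nat \<Rightarrow> (nat \<Rightarrow> nat) \<Rightarrow> nat \<Rightarrow> nat" where
  "greedy_step n \<kappa> p e f =
     (if f (fst e) = 0 \<and> card {j. j < n \<and> f j = snd e * n + p} < \<kappa>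
      then f(fst e := snd e * n + p) else f)"

text \<open>Passes are numbered from 1, so every code \<open>b * n + p\<close> is nonzero and
  \<open>0\<close> stays free for unmatched vertices; for \<open>p < n\<close>, division by
  \<open>n\<close> with remainder recovers both parts.\<close>

fun greedy_rounds :: "nat \<Rightarrow> nat \<Rightarrow> (nat \<times> nat) list \<Rightarrow> nat \<Rightarrow> nat \<Rightarrow> nat" where
  "greedy_rounds n \<kappa> es 0 = (\<lambda>_. 0)"
| "greedy_rounds n \<kappa> es (Suc p) = fold (greedy_step n \<kappa> (Suc p)) es (greedy_rounds n \<kappa> es p)"

section \<open>Persistence, capacity and origin of assignments\<close>

lemma greedy_step_keeps: "f j \<noteq> 0 \<Longrightarrow> greedy_step n \<kappa> p e f j = f j"
  by (auto simp: greedy_step_def)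

lemma fold_greedy_step_keeps: "f j \<noteq> 0 \<Longrightarrow> fold (greedy_step n \<kappa> p) es f j = f j"
  by (induction es arbitrary: f) (auto simp: greedy_step_keeps)

text \<open>Among nonzero codes, only the class of the one being written can grow, by one element,
  and the step writes only while that class is below \<open>\<kappa>\<close>.\<close>

lemma greedy_step_capacity:
  assumes "\<And>v. v \<noteq> 0 \<Longrightarrow> card {j. j < n \<and> f j = v} \<le> \<kappa>" and "v \<noteq> 0"
  shows "card {j. j < n \<and> greedy_step n \<kappa> p e f j = v} \<le> \<kappa>"
proof (cases "f (fst e) = 0 \<and> card {j. j < n \<and> f j = snd e * n + p} < \<kappa>")
  case False
  then have "greedy_step n \<kappa> p e f = f" by (auto simp: greedy_step_def)
  then show ?thesis using assms by simp
next
  case True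
  then have eq: "greedy_step n \<kappa> p e f = f(fst e := snd e * n + p)"
    by (simp add: greedy_step_def)
  show ?thesis
  proof (cases "v = snd e * n + p")
    case v: True
    have "card {j. j < n \<and> greedy_step n \<kappa> p e f j = v}
        \<le> card (insert (fst e) {j. j < n \<and> f j = snd e * n + p})"
      by (rule card_mono) (auto simp: eq v)
    also have "\<dots> \<le> Suc (card {j. j < n \<and> f j = snd e * n + p})"
      by (rule card_insert_le_m1) auto
    finally show ?thesis using True by linarith
  next
    case False
    have "card {j. j < n \<and> greedy_step n \<kappa> p e f j = v} \<le> card {j. j < n \<and> f j = v}"
      using False by (intro card_mono) (auto simp: eq split: if_splits)
    then show ?thesis using assms(1)[OF assms(2)] by linarith
  qed
qed

lemma fold_greedy_step_capacity:
  assumes "\<And>v. v \<noteq> 0 \<Longrightarrow> card {j. j < n \<and> f j = v} \<le> \<kappa>" and "v \<noteq> 0"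
  shows "card {j. j < n \<and> fold (greedy_step n \<kappa> p) es f j = v} \<le> \<kappa>"
  using assms
proof (induction es arbitrary: f v)
  case (Cons e es)
  show ?case
    using Cons.IH[of "greedy_step n \<kappa> p e f" v] greedy_step_capacity[OF Cons.prems(1)] Cons.prems(2)
    by simp
qed simp

text \<open>The pass number is part of the code, so the capacity is granted to each right-hand
  vertex afresh in every pass.\<close>

lemma greedy_rounds_capacity:
  "v \<noteq> 0 \<Longrightarrow> card {j. j < n \<and> greedy_rounds n \<kappa> es p j = v} \<le> \<kappa>"
  by (induction p arbitrary: v) (simp_all add: fold_greedy_step_capacity)

lemma fold_greedy_step_cases:
  "fold (greedy_step n \<kappa> p) es f j = f j \<or>
   (\<exists>b. (j, b) \<in> set es \<and> fold (greedy_step n \<kappa> p) es f j = b * n + p)"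
proof (induction es arbitrary: f)
  case (Cons e es)
  have "greedy_step n \<kappa> p e f j = f j \<or> fst e = j \<and> greedy_step n \<kappa> p e f j = snd e * n + p"
    by (auto simp: greedy_step_def)
  then show ?case using Cons.IH[of "greedy_step n \<kappa> p e f"]
    by (cases e) auto
qed simp

lemma greedy_rounds_cases:
  "greedy_rounds n \<kappa> es p j = 0 \<or>
   (\<exists>b p'. (j, b) \<in> set es \<and> 1 \<le> p' \<and> p' \<le> p \<and> greedy_rounds n \<kappa> es p j = b * n + p')"
proof (induction p)
  case (Suc p)
  let ?g = "greedy_rounds n \<kappa> es"
  consider "?g (Suc p) j = ?g p j" | b where "(j, b) \<in> set es" "?g (Suc p) j = b * n + Suc p"
    using fold_greedy_step_cases[of n \<kappa> "Suc p" es "?g p" j] by auto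
  then show ?case
  proof cases
    case 1
    then show ?thesis using Suc.IH le_SucI[of _ p] by metis
  next
    case 2
    then show ?thesis by (intro disjI2 exI[of _ b] exI[of _ "Suc p"]) simp
  qed
qed simp

section \<open>Counting the vertices that the passes leave unmatched\<close>

text \<open>Split the stream at the edge \<open>(a, b)\<close>. As matches persist, \<open>a\<close>
  was unmatched at that moment, so only a full class can explain the refusal, and a class never
  shrinks afterwards.\<close>

lemma fold_greedy_step_saturates:
  assumes "(a, b) \<in> set es" "0 < p" "fold (greedy_step n \<kappa> p) es f a = 0"
  shows "\<kappa> \<le> card {j. j < n \<and> fold (greedy_step n \<kappa> p) es f j = b * n + p}"
proof -
  let ?F = "fold (greedy_step n \<kappa> p)"
  from assms(1) obtain xs ys where es: "es = xs @ (a, b) # ys" by (meson split_list)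
  define g where "g = ?F xs f"
  define h where "h = greedy_step n \<kappa> p (a, b) g"
  have F: "?F es f = ?F ys h" by (simp add: es h_def g_def)
  have ha: "h a = 0" using fold_greedy_step_keeps[of h a n \<kappa> p ys] assms(3) F by metis
  then have ga: "g a = 0" unfolding h_def using greedy_step_keeps by metis
  have "\<kappa> \<le> card {j. j < n \<and> g j = b * n + p}"
  proof (rule ccontr)
    assume "\<not> ?thesis"
    then have "h a = b * n + p" using ga by (simp add: h_def greedy_step_def)
    then show False using ha \<open>0 < p\<close> by simp
  qed
  also have "\<dots> \<le> card {j. j < n \<and> ?F es f j = b * n + p}"
  proof (rule card_mono)
    show "{j. j < n \<and> g j = b * n + p} \<subseteq> {j. j < n \<and> ?F es f j = b * n + p}"
    proof (clarify)
      fix j assume "g j = b * n + p"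
      then have "g j \<noteq> 0" using \<open>0 < p\<close> by simp
      then have "h j = g j" unfolding h_def by (rule greedy_step_keeps)
      then have "?F ys h j = g j" using fold_greedy_step_keeps[of h j] \<open>g j \<noteq> 0\<close> by simp
      then show "?F es f j = b * n + p" using F \<open>g j = b * n + p\<close> by simp
    qed
  qed simp
  finally show ?thesis .
qed

text \<open>The unmatched set \<open>U\<close> is covered by fibres of \<open>\<sigma>\<close> of
  size at most \<open>d\<close>, so \<open>card U\<close> is at most \<open>d\<close> times the size
  of its image. Each image vertex is saturated and holds at least \<open>2 * d\<close> vertices of
  this pass, so the pass matched at least \<open>2 * card U\<close> vertices.\<close>

lemma fold_greedy_step_shrinks:
  assumes p: "0 < p" "p < n"
    and \<sigma>: "\<And>j. j < n \<Longrightarrow> (j, \<sigma> j) \<in> set es"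
    and d: "\<And>b. card {j. j < n \<and> \<sigma> j = b} \<le> d" "2 * d \<le> \<kappa>"
    and fresh: "\<And>j b. j < n \<Longrightarrow> f j \<noteq> b * n + p"
  shows "3 * card {j. j < n \<and> fold (greedy_step n \<kappa> p) es f j = 0} \<le> card {j. j < n \<and> f j = 0}"
proof -
  define g where "g = fold (greedy_step n \<kappa> p) es f"
  define U where "U = {j. j < n \<and> g j = 0}"
  define M where "M b = {j. j < n \<and> g j = b * n + p}" for b
  have [simp]: "finite U" "\<And>b. finite (M b)" by (auto simp: U_def M_def)
  have "card U = card (\<Union>b\<in>\<sigma> ` U. {j \<in> U. \<sigma> j = b})" by (rule arg_cong[of _ _ card]) auto
  also have "\<dots> \<le> (\<Sum>b\<in>\<sigma> ` U. card {j \<in> U. \<sigma> j = b})"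
    by (rule card_UN_le) simp
  also have "\<dots> \<le> (\<Sum>b\<in>\<sigma> ` U. d)"
  proof (rule sum_mono)
    fix b
    have "card {j \<in> U. \<sigma> j = b} \<le> card {j. j < n \<and> \<sigma> j = b}"
      by (rule card_mono) (auto simp: U_def)
    then show "card {j \<in> U. \<sigma> j = b} \<le> d" using d(1)[of b] by linarith
  qed
  finally have U: "card U \<le> card (\<sigma> ` U) * d" by simp
  have "2 * card U \<le> card (\<sigma> ` U) * \<kappa>"
    using U mult_le_mono2[OF d(2), of "card (\<sigma> ` U)"] by linarith
  also have "\<dots> = (\<Sum>b\<in>\<sigma> ` U. \<kappa>)" by simp
  also have "\<dots> \<le> (\<Sum>b\<in>\<sigma> ` U. card (M b))"
  proof (rule sum_mono)
    fix b assume "b \<in> \<sigma> ` U"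
    then obtain j where "j < n" "g j = 0" "b = \<sigma> j" by (auto simp: U_def)
    then show "\<kappa> \<le> card (M b)"
      using fold_greedy_step_saturates[OF \<sigma> p(1), of j n \<kappa> f] by (simp add: M_def g_def)
  qed
  also have "\<dots> = card (\<Union>b\<in>\<sigma> ` U. M b)"
    using p by (intro card_UN_disjoint[symmetric]) (auto simp: M_def)
  finally have M: "2 * card U \<le> card (\<Union>b\<in>\<sigma> ` U. M b)" .
  have keeps: "g j = f j" if "f j \<noteq> 0" for j
    using that unfolding g_def by (rule fold_greedy_step_keeps)
  have "card U + card (\<Union>b\<in>\<sigma> ` U. M b) = card (U \<union> (\<Union>b\<in>\<sigma> ` U. M b))"
    using p by (intro card_Un_disjoint[symmetric]) (auto simp: U_def M_def)
  \<comment> \<open>By \<open>fresh\<close>, a vertex bearing a code of this pass did not bear it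
    before; as nonzero values persist, it was unmatched.\<close>
  also have "\<dots> \<le> card {j. j < n \<and> f j = 0}"
    using keeps fresh by (intro card_mono) (force simp: U_def M_def)+
  finally show ?thesis using M unfolding U_def g_def by linarith
qed

text \<open>Reducing modulo \<open>n\<close> recovers the pass number, and the values so far carry
  numbers up to \<open>p\<close> only.\<close>

lemma greedy_rounds_fresh:
  assumes "p < p'" "p' < n"
  shows "greedy_rounds n \<kappa> es p j \<noteq> b * n + p'"
proof
  assume *: "greedy_rounds n \<kappa> es p j = b * n + p'"
  with assms have "greedy_rounds n \<kappa> es p j \<noteq> 0" by simp
  then obtain c r where "r \<le> p" "greedy_rounds n \<kappa> es p j = c * n + r"
    using greedy_rounds_cases[of n \<kappa> es p j] by metis
  with * have "(c * n + r) mod n = (b * n + p') mod n" by simp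
  then show False using assms \<open>r \<le> p\<close> by simp
qed

lemma greedy_rounds_unmatched:
  assumes "p < n"
    and \<sigma>: "\<And>j. j < n \<Longrightarrow> (j, \<sigma> j) \<in> set es"
    and d: "\<And>b. card {j. j < n \<and> \<sigma> j = b} \<le> d" "2 * d \<le> \<kappa>"
  shows "3 ^ p * card {j. j < n \<and> greedy_rounds n \<kappa> es p j = 0} \<le> n"
  using assms(1)
proof (induction p)
  case (Suc p)
  have "3 * card {j. j < n \<and> greedy_rounds n \<kappa> es (Suc p) j = 0}
      \<le> card {j. j < n \<and> greedy_rounds n \<kappa> es p j = 0}"
    unfolding greedy_rounds.simps
    using Suc.prems
    by (intro fold_greedy_step_shrinks[OF _ _ \<sigma> d] greedy_rounds_fresh) auto
  then have "3 ^ p * (3 * card {j. j < n \<and> greedy_rounds n \<kappa> es (Suc p) j = 0}) \<le> n"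
    using Suc.IH Suc.prems by (meson Suc_lessD le_trans mult_le_mono2)
  then show ?case by (simp add: algebra_simps)
qed simp

text \<open>Leaving \<open>j\<close> unmatched would take at least \<open>n\<close> matched vertices
  other than \<open>j\<close>. This later guarantees that some capacity succeeds.\<close>

lemma greedy_rounds_complete:
  assumes "n \<le> \<kappa>" "j < n" "(j, b) \<in> set es" "0 < p"
  shows "greedy_rounds n \<kappa> es p j \<noteq> 0"
proof
  assume 0: "greedy_rounds n \<kappa> es p j = 0"
  obtain r where r: "p = Suc r" using \<open>0 < p\<close> by (cases p) auto
  let ?g = "greedy_rounds n \<kappa> es p"
  have "\<kappa> \<le> card {i. i < n \<and> ?g i = b * n + p}"
    using fold_greedy_step_saturates[OF assms(3), of p n \<kappa> "greedy_rounds n \<kappa> es r"] 0 r by simp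
  also have "\<dots> \<le> card ({..<n} - {j})"
    using 0 \<open>0 < p\<close> by (intro card_mono) auto
  also have "\<dots> < n" using \<open>j < n\<close> by simp
  finally show False using assms(1) by simp
qed

text \<open>The fibre of \<open>div n\<close> over \<open>b\<close> splits by pass number, and each
  of the \<open>p\<close> passes contributes at most \<open>\<kappa>\<close>.\<close>

lemma greedy_rounds_degree:
  assumes "p < n" "\<And>j. j < n \<Longrightarrow> greedy_rounds n \<kappa> es p j \<noteq> 0"
  shows "card {j. j < n \<and> greedy_rounds n \<kappa> es p j div n = b} \<le> p * \<kappa>"
proof -
  let ?g = "greedy_rounds n \<kappa> es p"
  have "{j. j < n \<and> ?g j div n = b} \<subseteq> (\<Union>r\<in>{1..p}. {j. j < n \<and> ?g j = b * n + r})"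
  proof (clarify)
    fix j assume j: "j < n" "b = ?g j div n"
    then obtain c r where *: "1 \<le> r" "r \<le> p" "?g j = c * n + r"
      using greedy_rounds_cases[of n \<kappa> es p j] assms(2) by blast
    then have "?g j div n = c" using assms(1) by simp
    then show "j \<in> (\<Union>r\<in>{1..p}. {i. i < n \<and> ?g i = ?g j div n * n + r})" using * j by auto
  qed
  then have "card {j. j < n \<and> ?g j div n = b} \<le> card (\<Union>r\<in>{1..p}. {j. j < n \<and> ?g j = b * n + r})"
    by (rule card_mono[rotated]) auto
  also have "\<dots> \<le> (\<Sum>r\<in>{1..p}. card {j. j < n \<and> ?g j = b * n + r})" by (rule card_UN_le) simp
  also have "\<dots> \<le> (\<Sum>r\<in>{1..p}. \<kappa>)"
    by (intro sum_mono greedy_rounds_capacity) auto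
  finally show ?thesis by simp
qed

lemma greedy_rounds_edge:
  assumes "greedy_rounds n \<kappa> es p j \<noteq> 0" "p < n"
  shows "(j, greedy_rounds n \<kappa> es p j div n) \<in> set es"
proof -
  obtain b r where "(j, b) \<in> set es" "r \<le> p" "greedy_rounds n \<kappa> es p j = b * n + r"
    using greedy_rounds_cases[of n \<kappa> es p j] assms(1) by blast
  then show ?thesis using assms(2) by simp
qed

section \<open>The streaming program\<close>

text \<open>Asking for a derivation covers termination and resources at once, since an execution
  beyond \<open>N\<close> cells or \<open>w\<close> bits has none.\<close>

definition wp :: "nat \<Rightarrow> nat \<Rightarrow> com \<Rightarrow> (memory \<times> edge_output \<Rightarrow> bool) \<Rightarrow> memory \<times> edge_output \<Rightarrow> bool" where
  "wp N w c Q st \<longleftrightarrow> (\<exists>st'. exec N w c st st' \<and> Q st')"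

lemma wp_Skip: "Q st \<Longrightarrow> wp N w Skip Q st"
  unfolding wp_def by (blast intro: exec.Skip)

lemma wp_Store:
  "fits N w s e \<and> fits N w s f \<and> val s e < N \<and> Q (s(val s e := val s f), out)
   \<Longrightarrow> wp N w (Store e f) Q (s, out)"
  unfolding wp_def by (blast intro: exec.Store)

lemma wp_Emit:
  "fits N w s e \<and> fits N w s f \<and> Q (s, insert (val s e, val s f) out)
   \<Longrightarrow> wp N w (Emit e f) Q (s, out)"
  unfolding wp_def by (blast intro: exec.Emit)

lemma wp_Seq: "wp N w c (wp N w d Q) st \<Longrightarrow> wp N w (Seq c d) Q st"
  unfolding wp_def by (blast intro: exec.Seq)

lemma wp_Cond:
  "\<lbrakk>fits N w s e; val s e \<noteq> 0 \<Longrightarrow> wp N w c Q (s, out); val s e = 0 \<Longrightarrow> wp N w d Q (s, out)\<rbrakk>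
   \<Longrightarrow> wp N w (Cond e c d) Q (s, out)"
  unfolding wp_def by (cases "val s e = 0") (blast intro: exec.CondTrue exec.CondFalse)+

text \<open>As \<open>wp\<close> demands a terminating run, the invariant is accompanied by a
  measure \<open>\<mu>\<close>, and the proof is by induction on it.\<close>

lemma wp_While:
  fixes \<mu> :: "memory \<times> edge_output \<Rightarrow> nat"
  assumes "I st"
    and fits: "\<And>s out. I (s, out) \<Longrightarrow> fits N w s e"
    and step: "\<And>s out. I (s, out) \<Longrightarrow> val s e \<noteq> 0
      \<Longrightarrow> wp N w c (\<lambda>st'. I st' \<and> \<mu> st' < \<mu> (s, out)) (s, out)"
    and stop: "\<And>s out. I (s, out) \<Longrightarrow> val s e = 0 \<Longrightarrow> Q (s, out)"
  shows "wp N w (While e c) Q st"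
  using assms(1)
proof (induction "\<mu> st" arbitrary: st rule: less_induct)
  case less
  obtain s out where st: "st = (s, out)" by (cases st)
  have fit: "fits N w s e" using fits less.prems st by simp
  show ?case
  proof (cases "val s e = 0")
    case True
    then show ?thesis using exec.WhileFalse[OF fit] stop less.prems st unfolding wp_def by blast
  next
    case False
    then obtain st' where st': "exec N w c (s, out) st'" "I st'" "\<mu> st' < \<mu> st"
      using step less.prems st unfolding wp_def by blast
    then obtain st'' where "exec N w (While e c) st' st''" "Q st''"
      using less.hyps unfolding wp_def by blast
    then show ?thesis using exec.WhileTrue[OF fit False st'(1)] st unfolding wp_def by blast
  qed
qed

lemma wp_mono: "wp N w c Q st \<Longrightarrow> (\<And>st. Q st \<Longrightarrow> R st) \<Longrightarrow> wp N w c R st"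
  unfolding wp_def by blast

section \<open>The program\<close>

abbreviation reg :: "nat \<Rightarrow> expr" where "reg i \<equiv> Cell (Const i)"
abbreviation set_reg :: "nat \<Rightarrow> expr \<Rightarrow> com" where "set_reg i e \<equiv> Store (Const i) e"
text \<open>This is the code \<open>b * n + p\<close> of the current edge in the current
  pass.\<close>

abbreviation key :: expr where "key \<equiv> Add (Mul (reg 2) (reg 0)) (reg 3)"
text \<open>With truncated subtraction this is the absolute difference, which vanishes exactly when
  both values agree: an equality test.\<close>

abbreviation differ :: "expr \<Rightarrow> expr \<Rightarrow> expr" where "differ e f \<equiv> Add (Sub e f) (Sub f e)"

text \<open>Cell 0 holds \<open>n\<close>, cells 1 and 2 the current edge, cell 3 the pass number, cell 4 the start of
  the current block, cell 5 its capacity \<open>2 ^ i\<close>; cells 6 and 7 are a loop index and a counter. Block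
  \<open>i\<close>, the assignment for capacity \<open>2 ^ i < 2 * n\<close>, occupies the cells \<open>8 + i * n + j\<close> with \<open>j < n\<close>.
  The degree of \<open>b\<close> in the current pass is recounted for every edge, as \<open>B\<close> may be too large for one
  counter per vertex.\<close>

definition count_prog :: com where
  "count_prog =
     Seq (set_reg 6 (Const 0))
    (Seq (set_reg 7 (Const 0))
         (While (Sub (reg 0) (reg 6))
           (Seq (Cond (differ (Cell (Add (reg 4) (reg 6))) key)
                  Skip
                  (set_reg 7 (Add (reg 7) (Const 1))))
                (set_reg 6 (Add (reg 6) (Const 1))))))"

text \<open>Truncated subtraction also serves as strict comparison: \<open>Sub e f\<close> is
  nonzero exactly when \<open>f\<close> is below \<open>e\<close>. Here it tests for spare capacity;
  in the loops it tests the index against \<open>n\<close>.\<close>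

definition block_prog :: com where
  "block_prog =
     Cond (Cell (Add (reg 4) (reg 1)))
       Skip
       (Seq count_prog
         (Cond (Sub (reg 5) (reg 7))
           (Store (Add (reg 4) (reg 1)) key)
           Skip))"

text \<open>Capacity and block base advance together, so no block index is stored. Continuing while
  the capacity is below \<open>2 * n\<close> makes the last one at least \<open>n\<close>.\<close>

definition edge_prog :: com where
  "edge_prog =
     Seq (set_reg 4 (Const 8))
    (Seq (set_reg 5 (Const 1))
         (While (Sub (Mul (Const 2) (reg 0)) (reg 5))
           (Seq block_prog
           (Seq (set_reg 4 (Add (reg 4) (reg 0)))
                (set_reg 5 (Mul (Const 2) (reg 5)))))))"

text \<open>A gap sends the search to the start of the next block. There is no test for the last
  block; only a block without gaps ends the loop.\<close>

definition search_prog :: com where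
  "search_prog =
     Seq (set_reg 4 (Const 8))
    (Seq (set_reg 6 (Const 0))
         (While (Sub (reg 0) (reg 6))
           (Cond (Cell (Add (reg 4) (reg 6)))
             (set_reg 6 (Add (reg 6) (Const 1)))
             (Seq (set_reg 4 (Add (reg 4) (reg 0)))
                  (set_reg 6 (Const 0))))))"

definition output_prog :: com where
  "output_prog =
     Seq (set_reg 6 (Const 0))
         (While (Sub (reg 0) (reg 6))
           (Seq (Emit (reg 6) (Div (Cell (Add (reg 4) (reg 6))) (reg 0)))
                (set_reg 6 (Add (reg 6) (Const 1)))))"

text \<open>Zeroed memory already encodes the empty assignments, so \<open>init\<close> is idle. The
  pass counter is raised before the edges arrive, which gives the first pass the number 1.\<close>

definition greedy_alg :: stream_alg where
  "greedy_alg = \<lparr>init = Skip, begin_pass = set_reg 3 (Add (reg 3) (Const 1)),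
     edge = edge_prog, finish = Seq search_prog output_prog\<rparr>"

section \<open>Memory layout and word bounds\<close>

text \<open>\<open>K\<close> counts the capacities below \<open>2 * n\<close>, each with a block of
  \<open>n\<close> cells behind the 8 registers. A word holds every address and also
  \<open>4 * n\<close>, because the capacity is doubled once past \<open>2 * n\<close>.\<close>

locale machine =
  fixes n K N w :: nat
  assumes n: "2 \<le> n"
    and K: "\<And>i. 2 ^ i < 2 * n \<longleftrightarrow> i < K"
    and N: "N = 8 + K * n"
    and w: "N + 4 * n < 2 ^ w"
begin

text \<open>Cells 1 to 7 are left open, so that register updates preserve the predicate. The bound
  \<open>2 ^ w\<close> is carried along because \<open>fits\<close> requires it of every cell
  read.\<close>

definition holds :: "memory \<Rightarrow> (nat \<Rightarrow> nat \<Rightarrow> nat) \<Rightarrow> bool" where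
  "holds s f \<longleftrightarrow> s 0 = n \<and> (\<forall>i<K. \<forall>j<n. s (8 + i * n + j) = f i j \<and> f i j < 2 ^ w)"

lemma holds_register: "0 < x \<Longrightarrow> x < 8 \<Longrightarrow> holds (s(x := v)) f \<longleftrightarrow> holds s f"
  by (auto simp: holds_def)

lemma holds_n: "holds s f \<Longrightarrow> s 0 = n" by (simp add: holds_def)

lemma holds_block: "holds s f \<Longrightarrow> i < K \<Longrightarrow> j < n \<Longrightarrow> s (8 + i * n + j) = f i j"
  by (simp add: holds_def)

lemma holds_bound: "holds s f \<Longrightarrow> i < K \<Longrightarrow> j < n \<Longrightarrow> f i j < 2 ^ w"
  by (simp add: holds_def)

lemma address_inj:
  assumes "j < n" "j' < n"
  shows "i * n + j = i' * n + j' \<longleftrightarrow> i = i' \<and> j = j'"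
proof
  assume *: "i * n + j = i' * n + j'"
  then have "(i * n + j) div n = (i' * n + j') div n" "(i * n + j) mod n = (i' * n + j') mod n"
    by simp_all
  then show "i = i' \<and> j = j'" using assms by simp
qed simp

lemma holds_update:
  assumes "holds s f" "i < K" "j < n" "v < 2 ^ w"
  shows "holds (s(8 + i * n + j := v)) (f(i := (f i)(j := v)))"
  using assms by (auto simp: holds_def address_inj)

lemma address_less: "i < K \<Longrightarrow> j < n \<Longrightarrow> 8 + i * n + j < N"
proof -
  assume "i < K" "j < n"
  then have "Suc i * n \<le> K * n" by (intro mult_le_mono1) simp
  then show ?thesis using N \<open>j < n\<close> by simp
qed

lemma address_less_word: "i < K \<Longrightarrow> j < n \<Longrightarrow> 8 + i * n + j < 2 ^ w"
  using address_less w by fastforce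

text \<open>The case \<open>i = K\<close> matters: \<open>edge_prog\<close> advances cell 4 once
  beyond the last block.\<close>

lemma base_less_word: "i \<le> K \<Longrightarrow> 8 + i * n < 2 ^ w"
  using N w mult_le_mono1[of i K n] by linarith

lemma small_less: "x < 8 \<Longrightarrow> x < N"
  using N by simp

lemma small_less_word: "x \<le> 8 \<Longrightarrow> x < (2::nat) ^ w" for x :: nat
  using N w n by linarith

lemma n_less_word: "x \<le> 4 * n \<Longrightarrow> x < 2 ^ w"
  using w by linarith

text \<open>\<open>fits\<close> also inspects the subterms of \<open>key\<close>, so the bound on
  the whole has to pass to its parts.\<close>

lemma key_parts_less:
  assumes "b * n + p < 2 ^ w"
  shows "b < 2 ^ w" "p < 2 ^ w" "b * n < 2 ^ w"
proof -
  have "b * 1 \<le> b * n" using n by (intro mult_le_mono2) simp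
  then show "b < 2 ^ w" "p < 2 ^ w" "b * n < 2 ^ w" using assms by linarith+
qed

lemma wp_set_reg:
  "\<lbrakk>i < 8; fits N w s e; val s e = v; Q (s(i := v), out)\<rbrakk> \<Longrightarrow> wp N w (set_reg i e) Q (s, out)"
  by (rule wp_Store) (auto simp: small_less small_less_word)

section \<open>Correctness of the program, from the inner loop outwards\<close>

text \<open>The invariant says that cell 7 is the count over all indices below cell 6. The clause on
  cells 1 to 5 is the frame condition for the enclosing programs.\<close>

lemma count_prog_correct:
  assumes s: "holds s f" "s 2 = b" "s 3 = p" "s 4 = 8 + i * n" "i < K" "b * n + p < 2 ^ w"
  shows "wp N w count_prog (\<lambda>(s', out'). out' = out \<and> holds s' f \<and>
     s' 7 = card {j. j < n \<and> f i j = b * n + p} \<and> (\<forall>x\<in>{1..5}. s' x = s x)) (s, out)"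
proof -
  define c where "c m = card {j. j < m \<and> f i j = b * n + p}" for m
  have c_Suc: "c (Suc m) = (if f i m = b * n + p then c m + 1 else c m)" for m
  proof -
    have "{j. j < Suc m \<and> f i j = b * n + p} =
      (if f i m = b * n + p then insert m {j. j < m \<and> f i j = b * n + p}
       else {j. j < m \<and> f i j = b * n + p})"
      by (auto simp: less_Suc_eq)
    then show ?thesis by (simp add: c_def)
  qed
  have c_le: "c m \<le> m" for m
  proof -
    have "c m \<le> card {..<m}" unfolding c_def by (rule card_mono) auto
    then show ?thesis by simp
  qed
  have b: "b < 2 ^ w" "p < 2 ^ w" "b * n < 2 ^ w"
    using key_parts_less[OF s(6)] by auto
  let ?I = "\<lambda>(s', out'). out' = out \<and> holds s' f \<and> s' 6 \<le> n \<and> s' 7 = c (s' 6) \<and>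
    (\<forall>x\<in>{1..5}. s' x = s x)"
  let ?\<mu> = "\<lambda>(s', out'). n - s' 6"
  have loop: "wp N w (While (Sub (reg 0) (reg 6))
           (Seq (Cond (differ (Cell (Add (reg 4) (reg 6))) key)
                  Skip
                  (set_reg 7 (Add (reg 7) (Const 1))))
                (set_reg 6 (Add (reg 6) (Const 1)))))
       (\<lambda>(s', out'). out' = out \<and> holds s' f \<and> s' 7 = c n \<and> (\<forall>x\<in>{1..5}. s' x = s x))
       (s(6 := 0, 7 := 0), out)"
  proof (rule wp_While[where I = ?I and \<mu> = ?\<mu>], goal_cases)
    case 1
    then show ?case using s by (auto simp: holds_register c_def)
  next
    case (2 s' out')
    then show ?case by (auto simp: holds_n small_less small_less_word n_less_word)
  next
    case (3 s' out')
    then have I: "holds s' f" "s' 6 < n" "s' 7 = c (s' 6)" "out' = out" "\<forall>x\<in>{1..5}. s' x = s x"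
      by (auto simp: holds_n)
    have regs: "s' 0 = n" "s' 2 = b" "s' 3 = p" "s' 4 = 8 + i * n"
      using I s by (auto simp: holds_n)
    have cell: "s' (8 + i * n + s' 6) = f i (s' 6)" "f i (s' 6) < 2 ^ w"
      "8 + i * n + s' 6 < N" "8 + i * n + s' 6 < 2 ^ w" "8 + i * n < 2 ^ w"
      using I s address_less address_less_word base_less_word
      by (auto simp: holds_block holds_bound)
    have bounds: "c (s' 6) + 1 < 2 ^ w" "s' 6 + 1 < 2 ^ w" "s' 6 < 2 ^ w" "c (s' 6) < 2 ^ w" "n < 2 ^ w"
      using c_le[of "s' 6"] I(2) n by (auto intro!: n_less_word)
    have differ: "val s' (differ (Cell (Add (reg 4) (reg 6))) key) =
        f i (s' 6) - (b * n + p) + (b * n + p - f i (s' 6))"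
      using regs cell(1) by simp
    have next_ok: "wp N w (set_reg 6 (Add (reg 6) (Const 1)))
        (\<lambda>st'. ?I st' \<and> ?\<mu> st' < ?\<mu> (s', out')) (s'', out')"
      if "holds s'' f" "s'' 7 = c (Suc (s' 6))" "s'' 6 = s' 6" "\<forall>x\<in>{1..5}. s'' x = s x" for s''
    proof (rule wp_set_reg[where v = "Suc (s' 6)"], goal_cases)
      case 4
      have "holds (s''(6 := Suc (s' 6))) f" using that by (simp add: holds_register)
      then show ?case using that I by auto
    qed (use that bounds in \<open>simp_all add: small_less small_less_word\<close>)
    show ?case
    proof (rule wp_Seq, rule wp_Cond, goal_cases)
      case 1
      \<comment> \<open>One of the two truncated differences is 0, so their sum does not exceed the
        larger operand and fits into a word.\<close>
      have "f i (s' 6) - (b * n + p) + (b * n + p - f i (s' 6)) < 2 ^ w"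
        using cell(2) s(6) by linarith
      then show ?case using regs cell bounds b s(6) by (simp add: small_less small_less_word)
    next
      case 2
      then have "f i (s' 6) \<noteq> b * n + p" unfolding differ by linarith
      then show ?case using I by (intro wp_Skip next_ok) (simp_all add: c_Suc)
    next
      case 3
      then have eq: "f i (s' 6) = b * n + p" unfolding differ by linarith
      show ?case
      proof (rule wp_set_reg[where v = "Suc (c (s' 6))"], goal_cases)
        case 4
        show ?case using I eq by (intro next_ok) (simp_all add: c_Suc holds_register)
      qed (use I bounds in \<open>simp_all add: small_less small_less_word\<close>)
    qed
  next
    case (4 s' out')
    then have I: "holds s' f" "s' 6 \<le> n" "s' 7 = c (s' 6)" "out' = out" "\<forall>x\<in>{1..5}. s' x = s x"
      by blast+
    have "s' 6 = n" using 4(2) I(2) holds_n[OF I(1)] by simp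
    then show ?case using I by simp
  qed
  show ?thesis
    unfolding count_prog_def
    by (rule wp_Seq, rule wp_set_reg[where v = 0, rotated 3], rule wp_Seq,
        rule wp_set_reg[where v = 0, rotated 3], rule loop[unfolded c_def]) (simp_all add: small_less_word)
qed

lemma block_prog_correct:
  assumes s: "holds s f" "s 1 = a" "s 2 = b" "s 3 = p" "s 4 = 8 + i * n" "s 5 = \<kappa>"
    and "a < n" "i < K" "b * n + p < 2 ^ w" "\<kappa> < 2 ^ w"
  shows "wp N w block_prog (\<lambda>(s', out'). out' = out \<and>
     holds s' (f(i := greedy_step n \<kappa> p (a, b) (f i))) \<and> (\<forall>x\<in>{1..5}. s' x = s x)) (s, out)"
proof -
  let ?f = "f(i := greedy_step n \<kappa> p (a, b) (f i))"
  let ?c = "card {j. j < n \<and> f i j = b * n + p}"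
  have b: "b < 2 ^ w" "p < 2 ^ w" "b * n < 2 ^ w"
    using key_parts_less[OF assms(9)] by auto
  have bounds: "a < 2 ^ w" "n < 2 ^ w" using \<open>a < n\<close> by (auto intro!: n_less_word)
  have cell: "s (8 + i * n + a) = f i a" "f i a < 2 ^ w"
      "8 + i * n + a < N" "8 + i * n + a < 2 ^ w" "8 + i * n < 2 ^ w"
    using assms address_less address_less_word base_less_word
    by (auto simp: holds_block holds_bound)
  have "?c \<le> card {..<n}" by (rule card_mono) auto
  then have c: "?c < 2 ^ w" by (intro n_less_word) simp
  show ?thesis
    unfolding block_prog_def
  proof (rule wp_Cond, goal_cases)
    case 1
    then show ?case using assms cell bounds by (auto simp: small_less small_less_word)
  next
    case 2
    then have "f i a \<noteq> 0" using assms cell by simp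
    then have "?f = f" by (auto simp: greedy_step_def)
    then show ?case using s(1) by (auto intro!: wp_Skip simp del: fun_upd_apply)
  next
    case 3
    then have fa: "f i a = 0" using assms cell by simp
    show ?case
    proof (rule wp_Seq, rule wp_mono[OF count_prog_correct[OF s(1,3,4,5) assms(8,9)]], clarify)
      fix s' :: memory and out' :: edge_output
      assume I: "holds s' f" "s' 7 = ?c" "\<forall>x\<in>{1..5}. s' x = s x"
      have regs: "s' 0 = n" "s' 1 = a" "s' 2 = b" "s' 3 = p" "s' 4 = 8 + i * n" "s' 5 = \<kappa>"
        using I s by (auto simp: holds_n)
      show "wp N w (Cond (Sub (reg 5) (reg 7)) (Store (Add (reg 4) (reg 1)) key) Skip)
          (\<lambda>(s', out'). out' = out \<and> holds s' ?f \<and> (\<forall>x\<in>{1..5}. s' x = s x)) (s', out)"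
      proof (rule wp_Cond, goal_cases)
        case 1
        then show ?case using regs I c assms(10) by (auto simp: small_less small_less_word)
      next
        case 2
        then have "?c < \<kappa>" using regs I by simp
        then have f: "?f = f(i := (f i)(a := b * n + p))"
          using fa by (simp add: greedy_step_def)
        have h: "holds (s'(8 + i * n + a := b * n + p)) ?f"
          unfolding f using I(1) assms by (intro holds_update)
        show ?case
          using h regs I(3) cell b bounds assms(9)
          by (intro wp_Store) (auto simp: small_less small_less_word simp del: fun_upd_apply, auto)
      next
        case 3
        then have "\<not> ?c < \<kappa>" using regs I by simp
        then have "?f = f" by (auto simp: greedy_step_def)
        then show ?case using I by (auto intro!: wp_Skip simp del: fun_upd_apply)
      qed
    qed
  qed
qed

lemma edge_prog_correct:
  assumes s: "holds s f" "s 1 = a" "s 2 = b" "s 3 = p"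
    and "a < n" "b * n + p < 2 ^ w"
  shows "wp N w edge_prog (\<lambda>(s', out'). out' = out \<and>
     holds s' (\<lambda>i. greedy_step n (2 ^ i) p (a, b) (f i)) \<and> s' 3 = p) (s, out)"
proof -
  \<comment> \<open>The assignments after the first \<open>m\<close> capacities have been served;
    the later blocks still hold \<open>f\<close>.\<close>
  define g where "g m i = (if i < m then greedy_step n (2 ^ i) p (a, b) (f i) else f i)" for m i
  have g0: "g 0 = f" by (auto simp: g_def)
  have g_Suc: "g (Suc m) = (g m)(m := greedy_step n (2 ^ m) p (a, b) (g m m))" for m
    by (auto simp: g_def less_Suc_eq)
  have pow: "2 ^ m \<le> 2 * n" if "m < K" for m :: nat
    using that K[of m] by simp
  have pow': "2 ^ m \<le> 4 * n" if "m \<le> K" for m :: nat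
  proof (cases m)
    case (Suc r)
    then show ?thesis using that K[of r] by simp
  qed (use n in simp)
  let ?R = "\<lambda>m (s', out'). out' = out \<and> m \<le> K \<and> holds s' (g m) \<and>
    s' 1 = a \<and> s' 2 = b \<and> s' 3 = p \<and> s' 4 = 8 + m * n \<and> s' 5 = (2::nat) ^ m"
  let ?I = "\<lambda>st. \<exists>m. ?R m st"
  \<comment> \<open>The distance of the block base from the end of memory drops by \<open>n\<close>
    in each round.\<close>
  let ?\<mu> = "\<lambda>(s', out'). 8 + K * n - s' 4"
  have loop: "wp N w (While (Sub (Mul (Const 2) (reg 0)) (reg 5))
           (Seq block_prog
           (Seq (set_reg 4 (Add (reg 4) (reg 0)))
                (set_reg 5 (Mul (Const 2) (reg 5))))))
       (\<lambda>(s', out'). out' = out \<and> holds s' (g K) \<and> s' 3 = p)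
       (s(4 := 8, 5 := 1), out)"
  proof (rule wp_While[where I = ?I and \<mu> = ?\<mu>], goal_cases)
    case 1
    show ?case using s by (intro exI[of _ 0]) (auto simp: holds_register g0)
  next
    case (2 s' out')
    then obtain m where m: "?R m (s', out')" by blast
    then have "s' 5 < 2 ^ w" using pow'[of m] by (intro n_less_word) simp
    then show ?case using m by (auto simp: holds_n small_less small_less_word n_less_word)
  next
    case (3 s' out')
    then obtain m where m: "?R m (s', out')" by blast
    then have "(2::nat) ^ m < 2 * n" using 3(2) holds_n[of s' "g m"] by simp
    then have mK: "m < K" using K by simp
    have \<kappa>: "(2::nat) ^ m < 2 ^ w" using pow[OF mK] by (intro n_less_word) simp
    have \<kappa>2: "2 * (2::nat) ^ m < 2 ^ w" using pow[OF mK] by (intro n_less_word) simp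
    have base: "8 + m * n < 2 ^ w" "8 + Suc m * n < 2 ^ w" using mK by (auto intro!: base_less_word simp del: mult_Suc)
    have dec: "8 + K * n - (8 + m * n + n) < 8 + K * n - (8 + m * n)"
    proof -
      have "Suc m * n \<le> K * n" using mK by (intro mult_le_mono1) simp
      then show ?thesis using n by simp
    qed
    have pre: "holds s' (g m)" "s' 1 = a" "s' 2 = b" "s' 3 = p" "s' 4 = 8 + m * n" "s' 5 = 2 ^ m" "out' = out"
      using m by auto
    show ?case
    proof (rule wp_Seq, rule wp_mono[OF block_prog_correct[OF pre(1-6) assms(5) mK assms(6) \<kappa>]], goal_cases)
      case (1 st)
      then obtain s2 where st: "st = (s2, out')"
        and I: "holds s2 ((g m)(m := greedy_step n (2 ^ m) p (a, b) (g m m)))"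
          "\<forall>x\<in>{1..5}. s2 x = s' x"
        by (cases st) auto
      have regs: "s2 0 = n" "s2 1 = a" "s2 2 = b" "s2 3 = p" "s2 4 = 8 + m * n" "s2 5 = 2 ^ m"
        using I pre by (auto simp: holds_n)
      have R: "?R (Suc m) (s2(4 := 8 + m * n + n, 5 := 2 * 2 ^ m), out)"
        using I(1) regs mK unfolding g_Suc[symmetric] by (auto simp: holds_register)
      show ?case
        unfolding st
      proof (rule wp_Seq, rule wp_set_reg[where v = "8 + m * n + n"], goal_cases)
        case 4
        show ?case
        proof (rule wp_set_reg[where v = "2 * 2 ^ m"], goal_cases)
          case 4
          show ?case
          proof (rule conjI)
            show "?I (s2(4 := 8 + m * n + n, 5 := 2 * 2 ^ m), out')"
              by (rule exI[of _ "Suc m"]) (use R pre(7) in blast)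
          qed (use pre(5) dec in simp)
        qed (use regs \<kappa> \<kappa>2 in \<open>simp_all add: small_less small_less_word\<close>)
      qed (use regs base n_less_word[of n] in \<open>simp_all add: small_less small_less_word add_ac\<close>)
    qed
  next
    case (4 s' out')
    then obtain m where m: "?R m (s', out')" by blast
    then have "\<not> (2::nat) ^ m < 2 * n" using 4(2) holds_n[of s' "g m"] by simp
    then have "m = K" using K m by (simp add: not_less)
    then show ?case using m by auto
  qed
  \<comment> \<open>The two functions can differ only at indices from \<open>K\<close> on, which
    \<open>holds\<close> does not inspect.\<close>
  have gK: "holds s' (g K) = holds s' (\<lambda>i. greedy_step n (2 ^ i) p (a, b) (f i))" for s'
    by (auto simp: holds_def g_def)
  show ?thesis
    unfolding edge_prog_def gK[symmetric]
    by (rule wp_Seq, rule wp_set_reg[where v = 8, rotated 3], rule wp_Seq,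
        rule wp_set_reg[where v = 1, rotated 3], rule loop) (simp_all add: small_less_word)
qed

lemma feed_correct:
  assumes "holds s f" "s 3 = p" "\<And>a b. (a, b) \<in> set es \<Longrightarrow> a < n \<and> b * n + p < 2 ^ w"
  shows "\<exists>s'. feed N w edge_prog es (s, out) (s', out) \<and>
     holds s' (\<lambda>i. fold (greedy_step n (2 ^ i) p) es (f i)) \<and> s' 3 = p"
  using assms
proof (induction es arbitrary: s f)
  case Nil
  then show ?case by (auto intro!: exI[of _ s] feed.Nil)
next
  case (Cons e es)
  obtain a b where e: "e = (a, b)" by (cases e)
  have ab: "a < n" "b * n + p < 2 ^ w" using Cons.prems(3)[of a b] e by auto
  have lt: "a < 2 ^ w" "b < 2 ^ w"
    using n_less_word[of a] key_parts_less(1)[OF ab(2)] ab(1) by simp_all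
  have h: "holds (s(1 := a, 2 := b)) f" using Cons.prems(1) by (simp add: holds_register)
  obtain s' where s': "exec N w edge_prog (s(1 := a, 2 := b), out) (s', out)"
    "holds s' (\<lambda>i. greedy_step n (2 ^ i) p (a, b) (f i))" "s' 3 = p"
    using edge_prog_correct[OF h _ _ _ ab, of out] Cons.prems(2) unfolding wp_def by auto
  obtain s'' where s'': "feed N w edge_prog es (s', out) (s'', out)"
     "holds s'' (\<lambda>i. fold (greedy_step n (2 ^ i) p) es (greedy_step n (2 ^ i) p (a, b) (f i)))"
     "s'' 3 = p"
    using Cons.IH[OF s'(2,3) Cons.prems(3)] by auto
  have "feed N w edge_prog (e # es) (s, out) (s'', out)"
    unfolding e by (rule feed.Cons[OF small_less lt s'(1) s''(1)]) simp
  then show ?case using s''(2,3) e by auto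
qed

text \<open>Induction on the remaining passes with \<open>p\<close> arbitrary. The bounds refer to
  \<open>p + m\<close>, the number of the last pass, which stays the same in every induction
  step.\<close>

lemma passes_correct:
  assumes "holds s (\<lambda>i. greedy_rounds n (2 ^ i) es p)" "s 3 = p"
    and "\<And>a b. (a, b) \<in> set es \<Longrightarrow> a < n \<and> b * n + (p + m) < 2 ^ w" "p + m < 2 ^ w"
  shows "\<exists>s'. passes N w greedy_alg es m (s, out) (s', out) \<and>
     holds s' (\<lambda>i. greedy_rounds n (2 ^ i) es (p + m))"
  using assms
proof (induction m arbitrary: s p)
  case 0
  then show ?case by (auto intro!: exI[of _ s] passes.Zero)
next
  case (Suc m)
  have 1: "exec N w (begin_pass greedy_alg) (s, out) (s(3 := Suc p), out)"
    using exec.Store[of N w s "Const 3" "Add (reg 3) (Const 1)" out] Suc.prems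
    by (simp add: greedy_alg_def small_less small_less_word)
  have "\<exists>s'. feed N w edge_prog es (s(3 := Suc p), out) (s', out) \<and>
     holds s' (\<lambda>i. fold (greedy_step n (2 ^ i) (Suc p)) es (greedy_rounds n (2 ^ i) es p)) \<and>
     s' 3 = Suc p"
    using Suc.prems(1) by (intro feed_correct) (auto simp: holds_register dest!: Suc.prems(3))
  then obtain s' where 2: "feed N w (edge greedy_alg) es (s(3 := Suc p), out) (s', out)"
     "holds s' (\<lambda>i. greedy_rounds n (2 ^ i) es (Suc p))" "s' 3 = Suc p"
    by (auto simp: greedy_alg_def)
  obtain s'' where "passes N w greedy_alg es m (s', out) (s'', out)"
    "holds s'' (\<lambda>i. greedy_rounds n (2 ^ i) es (Suc p + m))"
    using Suc.IH[OF 2(2,3)] Suc.prems(3,4) by auto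
  then show ?case using passes.Suc[OF 1 2(1)] by auto
qed

text \<open>Block \<open>r\<close> is complete, so the search never moves past it; every earlier
  block has a gap, so the search cannot stop there.\<close>

lemma search_prog_correct:
  assumes s: "holds s f" and r: "r < K" "\<And>j. j < n \<Longrightarrow> f r j \<noteq> 0"
    "\<And>i. i < r \<Longrightarrow> \<exists>j<n. f i j = 0"
  shows "wp N w search_prog (\<lambda>(s', out'). out' = out \<and> holds s' f \<and> s' 4 = 8 + r * n) (s, out)"
proof -
  let ?R = "\<lambda>m (s', out'). out' = out \<and> m \<le> r \<and> holds s' f \<and>
    s' 4 = 8 + m * n \<and> s' 6 \<le> n \<and> (\<forall>j<s' 6. f m j \<noteq> 0)"
  let ?I = "\<lambda>st. \<exists>m. ?R m st"
  \<comment> \<open>Entering the next block lowers the first summand by \<open>2 * n\<close>, which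
    outweighs the fewer than \<open>n\<close> steps regained by resetting cell 6.\<close>
  let ?\<mu> = "\<lambda>(s', out'). (8 + r * n - s' 4) * 2 + (n - s' 6)"
  have loop: "wp N w (While (Sub (reg 0) (reg 6))
           (Cond (Cell (Add (reg 4) (reg 6)))
             (set_reg 6 (Add (reg 6) (Const 1)))
             (Seq (set_reg 4 (Add (reg 4) (reg 0)))
                  (set_reg 6 (Const 0)))))
       (\<lambda>(s', out'). out' = out \<and> holds s' f \<and> s' 4 = 8 + r * n)
       (s(4 := 8, 6 := 0), out)"
  proof (rule wp_While[where I = ?I and \<mu> = ?\<mu>], goal_cases)
    case 1
    show ?case using s by (intro exI[of _ 0]) (auto simp: holds_register)
  next
    case (2 s' out')
    then show ?case by (auto simp: holds_n small_less small_less_word n_less_word)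
  next
    case (3 s' out')
    then obtain m where m: "?R m (s', out')" by blast
    then have lt: "s' 6 < n" using 3(2) holds_n[of s' f] by simp
    have regs: "s' 0 = n" "s' 4 = 8 + m * n" using m by (auto simp: holds_n)
    have cell: "s' (8 + m * n + s' 6) = f m (s' 6)" "f m (s' 6) < 2 ^ w"
      "8 + m * n + s' 6 < N" "8 + m * n + s' 6 < 2 ^ w" "8 + m * n < 2 ^ w" "8 + Suc m * n < 2 ^ w"
      using m r(1) lt address_less address_less_word base_less_word[of m] base_less_word[of "Suc m"]
      by (auto simp: holds_block holds_bound simp del: mult_Suc)
    have bounds: "s' 6 + 1 < 2 ^ w" "s' 6 < 2 ^ w" "n < 2 ^ w"
      using lt by (auto intro!: n_less_word)
    show ?case
    proof (rule wp_Cond, goal_cases)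
      case 1
      then show ?case using regs cell bounds by (auto simp: small_less small_less_word)
    next
      case 2
      then have "f m (s' 6) \<noteq> 0" using regs cell by simp
      then have R: "?R m (s'(6 := s' 6 + 1), out')"
        using m lt by (auto simp: holds_register less_Suc_eq)
      show ?case
      proof (rule wp_set_reg[where v = "s' 6 + 1"], goal_cases)
        case 4
        show ?case
        proof (rule conjI)
          show "?I (s'(6 := s' 6 + 1), out')" by (rule exI[of _ m]) (fact R)
        qed (use lt in simp)
      qed (use bounds in \<open>simp_all add: small_less small_less_word\<close>)
    next
      case 3
      then have "f m (s' 6) = 0" using regs cell by simp
      then have "m \<noteq> r" using r(2) lt by metis
      then have mr: "m < r" using m by simp
      have R: "?R (Suc m) (s'(4 := 8 + m * n + n, 6 := 0), out')"
        using m mr by (auto simp: holds_register)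
      have "Suc m * n \<le> r * n" using mr by (intro mult_le_mono1) simp
      then have dec: "(8 + r * n - (8 + m * n + n)) * 2 + n < (8 + r * n - (8 + m * n)) * 2 + (n - s' 6)"
        using lt n by simp
      show ?case
      proof (rule wp_Seq, rule wp_set_reg[where v = "8 + m * n + n"], goal_cases)
        case 4
        show ?case
        proof (rule wp_set_reg[where v = 0], goal_cases)
          case 4
          show ?case
          proof (rule conjI)
            show "?I (s'(4 := 8 + m * n + n, 6 := 0), out')" by (rule exI[of _ "Suc m"]) (fact R)
          qed (use regs dec in simp)
        qed (simp_all add: small_less_word)
      qed (use regs cell bounds in \<open>simp_all add: small_less small_less_word add_ac\<close>)
    qed
  next
    case (4 s' out')
    then obtain m where m: "?R m (s', out')" by blast
    then have "s' 6 = n" using 4(2) holds_n[of s' f] by simp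
    then have "\<not> m < r" using m r(3) by force
    then show ?case using m by auto
  qed
  show ?thesis
    unfolding search_prog_def
    by (rule wp_Seq, rule wp_set_reg[where v = 8, rotated 3], rule wp_Seq,
        rule wp_set_reg[where v = 0, rotated 3], rule loop) (simp_all add: small_less_word)
qed

lemma output_prog_correct:
  assumes s: "holds s f" "s 4 = 8 + r * n" "r < K"
  shows "wp N w output_prog (\<lambda>(s', out'). out' = (\<lambda>j. (j, f r j div n)) ` {..<n}) (s, {})"
proof -
  let ?I = "\<lambda>(s', out'). holds s' f \<and> s' 4 = 8 + r * n \<and> s' 6 \<le> n \<and>
    out' = (\<lambda>j. (j, f r j div n)) ` {..<s' 6}"
  let ?\<mu> = "\<lambda>(s', out'). n - s' 6"
  have loop: "wp N w (While (Sub (reg 0) (reg 6))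
           (Seq (Emit (reg 6) (Div (Cell (Add (reg 4) (reg 6))) (reg 0)))
                (set_reg 6 (Add (reg 6) (Const 1)))))
       (\<lambda>(s', out'). out' = (\<lambda>j. (j, f r j div n)) ` {..<n}) (s(6 := 0), {})"
  proof (rule wp_While[where I = ?I and \<mu> = ?\<mu>], goal_cases)
    case 1
    show ?case using s by (auto simp: holds_register)
  next
    case (2 s' out')
    then show ?case by (auto simp: holds_n small_less small_less_word n_less_word)
  next
    case (3 s' out')
    then have I: "holds s' f" "s' 4 = 8 + r * n" "s' 6 < n" "s' 0 = n"
      "out' = (\<lambda>j. (j, f r j div n)) ` {..<s' 6}"
      by (auto simp: holds_n)
    have cell: "s' (8 + r * n + s' 6) = f r (s' 6)" "f r (s' 6) < 2 ^ w"
      "8 + r * n + s' 6 < N" "8 + r * n + s' 6 < 2 ^ w" "8 + r * n < 2 ^ w"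
      using I s address_less address_less_word base_less_word
      by (auto simp: holds_block holds_bound)
    have bounds: "s' 6 + 1 < 2 ^ w" "s' 6 < 2 ^ w" "n < 2 ^ w"
      using I(3) by (auto intro!: n_less_word)
    have quot: "f r (s' 6) div n < 2 ^ w"
      using cell(2) div_le_dividend by (rule le_less_trans[rotated])
    show ?case
    proof (rule wp_Seq, rule wp_Emit, intro conjI, goal_cases)
      case 3
      show ?case
      proof (rule wp_set_reg[where v = "Suc (s' 6)"], goal_cases)
        case 4
        have "holds (s'(6 := Suc (s' 6))) f" using I(1) by (simp add: holds_register)
        then show ?case using I cell by (auto simp: lessThan_Suc)
      qed (use bounds in \<open>simp_all add: small_less small_less_word\<close>)
    qed (use I cell bounds quot in \<open>simp_all add: small_less small_less_word\<close>)
  next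
    case (4 s' out')
    then show ?case by (auto simp: holds_n)
  qed
  show ?thesis
    unfolding output_prog_def
    by (rule wp_Seq, rule wp_set_reg[where v = 0, rotated 3], rule loop) (simp_all add: small_less_word)
qed

lemma streaming_run_greedy:
  assumes "\<And>a b. (a, b) \<in> set es \<Longrightarrow> a < n \<and> b * n + p < 2 ^ w" "p < 2 ^ w"
    and "r < K" "\<And>j. j < n \<Longrightarrow> greedy_rounds n (2 ^ r) es p j \<noteq> 0"
    and "\<And>i. i < r \<Longrightarrow> \<exists>j<n. greedy_rounds n (2 ^ i) es p j = 0"
  shows "streaming_run N w greedy_alg p n es
     ((\<lambda>j. (j, greedy_rounds n (2 ^ r) es p j div n)) ` {..<n})"
proof -
  \<comment> \<open>The initial memory represents the state after 0 passes for all capacities at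
    once, with pass number 0 in cell 3.\<close>
  have h0: "holds ((\<lambda>_. 0)(0 := n)) (\<lambda>i. greedy_rounds n (2 ^ i) es 0)"
    by (simp add: holds_def)
  obtain s where s: "passes N w greedy_alg es p ((\<lambda>_. 0)(0 := n), {}) (s, {})"
    "holds s (\<lambda>i. greedy_rounds n (2 ^ i) es p)"
    using passes_correct[OF h0, of p "{}"] assms(1,2) by auto
  have "wp N w (finish greedy_alg)
      (\<lambda>(s', out'). out' = (\<lambda>j. (j, greedy_rounds n (2 ^ r) es p j div n)) ` {..<n}) (s, {})"
    unfolding greedy_alg_def stream_alg.simps
    apply (rule wp_Seq, rule wp_mono[OF search_prog_correct[OF s(2) assms(3,4,5)]])
    using output_prog_correct[OF _ _ assms(3)] by auto
  moreover have "exec N w (init greedy_alg) ((\<lambda>_. 0)(0 := n), {}) ((\<lambda>_. 0)(0 := n), {})"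
    by (simp add: greedy_alg_def exec.Skip)
  ultimately show ?thesis
    using s(1) n_less_word[of n] N unfolding streaming_run_def wp_def by fastforce
qed

end

section \<open>Approximation ratio and space\<close>

text \<open>For \<open>x \<ge> 1\<close> every power is at most the leading one, so the absolute
  coefficients can be added up. Rounding up to a natural \<open>c\<close> lets the word size be
  computed in \<open>nat\<close>.\<close>

lemma poly_le_monomial:
  fixes q :: "real poly"
  obtains c d :: nat where "\<And>x. 1 \<le> x \<Longrightarrow> poly q x \<le> real c * x ^ d"
proof -
  define C where "C = (\<Sum>i\<le>degree q. \<bar>coeff q i\<bar>)"
  have "poly q x \<le> real (nat \<lceil>C\<rceil>) * x ^ degree q" if x: "1 \<le> x" for x
  proof -
    have "poly q x = (\<Sum>i\<le>degree q. coeff q i * x ^ i)" by (simp add: poly_altdef)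
    also have "\<dots> \<le> (\<Sum>i\<le>degree q. \<bar>coeff q i\<bar> * x ^ degree q)"
      using x by (intro sum_mono mult_mono power_increasing) auto
    also have "\<dots> = C * x ^ degree q" by (simp add: C_def sum_distrib_right)
    also have "\<dots> \<le> real (nat \<lceil>C\<rceil>) * x ^ degree q"
      using x by (intro mult_right_mono real_nat_ceiling_ge) simp
    finally show ?thesis .
  qed
  then show thesis by (rule that)
qed

lemma floor_log_bounds:
  assumes "2 \<le> n"
  defines "L \<equiv> nat \<lfloor>log 2 (real n)\<rfloor>"
  shows "1 \<le> L" "2 ^ L \<le> n" "n < 2 ^ (L + 1)" "real L \<le> log 2 (real n)"
proof -
  have l: "1 \<le> log 2 (real n)" using assms by (subst le_log_iff) auto
  then show "1 \<le> L" unfolding L_def by linarith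
  show L: "real L \<le> log 2 (real n)" using l unfolding L_def by linarith
  have L': "log 2 (real n) < real (L + 1)" using l unfolding L_def by linarith
  have "2 powr real L \<le> real n" using L assms(1) by (simp add: le_log_iff)
  then have "real (2 ^ L) \<le> real n" by (simp add: powr_realpow)
  then show "2 ^ L \<le> n" by (simp only: of_nat_le_iff)
  have "real n < 2 powr real (L + 1)" using L' assms(1) by (subst (asm) log_less_iff) auto
  then have "real n < real (2 ^ (L + 1))" by (subst (asm) powr_realpow) auto
  then show "n < 2 ^ (L + 1)" by (simp only: of_nat_less_iff)
qed

section \<open>Translation between vertices and their numbers\<close>

lemma deg_le_deg_max:
  assumes "bipartite_graph A B E" "v \<in> A \<union> B"
  shows "deg S v \<le> deg_max A B S"
  using assms unfolding deg_max_def bipartite_graph_def by (intro Max_ge) auto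

text \<open>\<open>\<sigma>\<close> is the partner function of \<open>S\<close> carried over to
  numbers. A nonempty fibre over \<open>c\<close> is covered by the images of the
  \<open>S\<close>-edges at the vertex of \<open>B\<close> with number \<open>c\<close>, so its size
  is at most that degree.\<close>

lemma semi_matching_numbered:
  assumes G: "bipartite_graph A B E" and num: "numbering A B num" and S: "semi_matching A E S"
  obtains \<sigma> where "\<And>j. j < card A \<Longrightarrow> (j, \<sigma> j) \<in> map_prod num num ` E"
    and "\<And>c. card {j. j < card A \<and> \<sigma> j = c} \<le> deg_max A B S"
proof -
  have E: "E \<subseteq> A \<times> B" "A \<inter> B = {}" "finite (A \<times> B)"
    using G by (auto simp: bipartite_graph_def)
  have "S \<subseteq> E" using S by (simp add: semi_matching_def)
  then have fin: "S \<subseteq> E" "finite S"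
    using finite_subset[OF order_trans[OF _ E(1)] E(3)] by simp_all
  have numA: "bij_betw num A {..<card A}" and numB: "inj_on num B"
    using num unfolding numbering_def by (blast, blast dest: bij_betw_imp_inj_on)
  have "\<exists>b. (a, b) \<in> S" if "a \<in> A" for a
  proof -
    have "deg S a = 1" using S that by (simp add: semi_matching_def)
    then have "card {e \<in> S. fst e = a \<or> snd e = a} \<noteq> 0" by (simp add: deg_def)
    then have "{e \<in> S. fst e = a \<or> snd e = a} \<noteq> {}" by (metis card.empty)
    then obtain e where e: "e \<in> S" "fst e = a \<or> snd e = a" by blast
    then have "snd e \<in> B" using fin(1) E(1) by auto
    then have "e = (a, snd e)" using e(2) E(2) that by (auto simp: prod_eq_iff)
    then show ?thesis using e(1) by metis
  qed
  then obtain h where h: "\<And>a. a \<in> A \<Longrightarrow> (a, h a) \<in> S" by metis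
  define v where "v = inv_into A num"
  have v: "v j \<in> A" "num (v j) = j" if "j < card A" for j
  proof -
    have "j \<in> num ` A" using that numA by (simp add: bij_betw_def)
    then show "v j \<in> A" "num (v j) = j"
      unfolding v_def by (rule inv_into_into, rule f_inv_into_f)
  qed
  define \<sigma> where "\<sigma> j = num (h (v j))" for j
  show thesis
  proof (rule that)
    fix j assume "j < card A"
    then have "(v j, h (v j)) \<in> E" "map_prod num num (v j, h (v j)) = (j, \<sigma> j)"
      using v[of j] h[of "v j"] fin(1) by (auto simp: \<sigma>_def)
    then show "(j, \<sigma> j) \<in> map_prod num num ` E" by (metis imageI)
  next
    fix c
    show "card {j. j < card A \<and> \<sigma> j = c} \<le> deg_max A B S"
    proof (cases "{j. j < card A \<and> \<sigma> j = c} = {}")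
      case False
      then obtain j\<^sub>0 where j0: "j\<^sub>0 < card A" "\<sigma> j\<^sub>0 = c" by blast
      define b where "b = h (v j\<^sub>0)"
      have b: "b \<in> B" using h[OF v(1)[OF j0(1)]] fin(1) E(1) by (auto simp: b_def)
      let ?D = "{e \<in> S. fst e = b \<or> snd e = b}"
      have "{j. j < card A \<and> \<sigma> j = c} \<subseteq> (\<lambda>e. num (fst e)) ` ?D"
      proof clarify
        fix j assume j: "j < card A" "c = \<sigma> j"
        have hB: "h (v j) \<in> B" using h[OF v(1)[OF j(1)]] fin(1) E(1) by auto
        have "num (h (v j)) = num b" using j j0 by (simp add: \<sigma>_def b_def)
        then have "h (v j) = b" using inj_on_eq_iff[OF numB hB b] by simp
        then have "(v j, b) \<in> ?D" using h[OF v(1)[OF j(1)]] by auto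
        then show "j \<in> (\<lambda>e. num (fst e)) ` ?D" by (rule rev_image_eqI) (simp add: v(2)[OF j(1)])
      qed
      then have "card {j. j < card A \<and> \<sigma> j = c} \<le> deg S b"
        unfolding deg_def using fin(2) by (intro surj_card_le) auto
      then show ?thesis using deg_le_deg_max[OF G, of b S] b by simp
    next
      case True
      then show ?thesis by (simp only: card.empty zero_le)
    qed
  qed
qed

text \<open>The converse translation: \<open>S\<close> consists of the edges whose numbers lie on
  the graph of \<open>g\<close>, and injectivity of \<open>num\<close> on each side transfers the
  counts. \<open>1 \<le> D\<close> covers the vertices of \<open>A\<close>, whose degree 1 enters
  \<open>deg_max\<close> too.\<close>

lemma numbered_semi_matching:
  assumes G: "bipartite_graph A B E" and num: "numbering A B num" and "A \<noteq> {}"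
    and g: "\<And>j. j < card A \<Longrightarrow> (j, g j) \<in> map_prod num num ` E"
    and D: "\<And>c. card {j. j < card A \<and> g j = c} \<le> D" "1 \<le> D"
  obtains S where "semi_matching A E S" "map_prod num num ` S = (\<lambda>j. (j, g j)) ` {..<card A}"
    "deg_max A B S \<le> D"
proof -
  define S where "S = {e \<in> E. g (num (fst e)) = num (snd e)}"
  have E: "E \<subseteq> A \<times> B" "A \<inter> B = {}" "finite A" "finite B"
    using G by (auto simp: bipartite_graph_def)
  have injA: "inj_on num A" and injB: "inj_on num B" and imA: "num ` A = {..<card A}"
    using num unfolding numbering_def bij_betw_def by blast+
  have lt: "num a < card A" if "a \<in> A" for a using that imA by auto
  have edge: "\<exists>b. {e \<in> S. fst e = a \<or> snd e = a} = {(a, b)}" if a: "a \<in> A" for a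
  proof -
    obtain a' b where ab: "(a', b) \<in> E" "num a = num a'" "g (num a) = num b"
      using g[OF lt[OF a]] by auto
    then have vs: "a' \<in> A" "b \<in> B" using E(1) by auto
    have "a' = a" using inj_on_eq_iff[OF injA a vs(1)] ab(2) by simp
    then have mem: "(a, b) \<in> S" using ab by (simp add: S_def)
    have uniq: "e = (a, b)" if e: "e \<in> S" "fst e = a \<or> snd e = a" for e
    proof -
      have "e \<in> E" "g (num (fst e)) = num (snd e)" using e(1) by (simp_all add: S_def)
      then have B: "snd e \<in> B" using E(1) by auto
      then have fst: "fst e = a" using e(2) a E(2) by blast
      then have "num (snd e) = num b" using ab(3) \<open>g (num (fst e)) = num (snd e)\<close> by simp
      then have "snd e = b" using B vs(2) by (rule inj_onD[OF injB])
      with fst show ?thesis by (simp add: prod_eq_iff)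
    qed
    have "{e \<in> S. fst e = a \<or> snd e = a} = {(a, b)}"
    proof (rule equalityI; rule subsetI)
      fix e assume "e \<in> {e \<in> S. fst e = a \<or> snd e = a}"
      then have "e \<in> S" "fst e = a \<or> snd e = a" by simp_all
      then have "e = (a, b)" by (rule uniq)
      then show "e \<in> {(a, b)}" by simp
    next
      fix e assume "e \<in> {(a, b)}"
      then show "e \<in> {e \<in> S. fst e = a \<or> snd e = a}" using mem by simp
    qed
    then show ?thesis ..
  qed
  have degA: "deg S a = 1" if a: "a \<in> A" for a
    using edge[OF a] unfolding deg_def by (elim exE) simp
  have degB: "deg S b \<le> D" if b: "b \<in> B" for b
  proof -
    let ?D = "{e \<in> S. fst e = b \<or> snd e = b}"
    have snd: "snd e = b \<and> fst e \<in> A" if e: "e \<in> ?D" for e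
    proof -
      have "e \<in> A \<times> B" using e E(1) by (auto simp: S_def)
      then have "fst e \<in> A" by auto
      then show ?thesis using e b E(2) by auto
    qed
    have "inj_on (\<lambda>e. num (fst e)) ?D"
    proof (rule inj_onI)
      fix e e' assume *: "e \<in> ?D" "e' \<in> ?D" "num (fst e) = num (fst e')"
      then have "fst e = fst e'" using inj_on_eq_iff[OF injA] snd by blast
      then show "e = e'" using snd[OF *(1)] snd[OF *(2)] by (simp add: prod_eq_iff)
    qed
    moreover have "(\<lambda>e. num (fst e)) ` ?D \<subseteq> {j. j < card A \<and> g j = num b}"
    proof (rule image_subsetI)
      fix e assume e: "e \<in> ?D"
      then have "g (num (fst e)) = num (snd e)" by (simp add: S_def)
      then show "num (fst e) \<in> {j. j < card A \<and> g j = num b}" using snd[OF e] lt by simp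
    qed
    ultimately have "card ?D \<le> card {j. j < card A \<and> g j = num b}"
      by (intro card_inj_on_le) auto
    then show ?thesis using D(1)[of "num b"] unfolding deg_def by linarith
  qed
  show thesis
  proof (rule that)
    show "semi_matching A E S" using degA by (auto simp: semi_matching_def S_def)
    show "map_prod num num ` S = (\<lambda>j. (j, g j)) ` {..<card A}"
    proof (intro equalityI subsetI)
      fix x assume "x \<in> map_prod num num ` S"
      then obtain a b where ab: "(a, b) \<in> E" "g (num a) = num b" "x = (num a, num b)"
        by (auto simp: S_def)
      then have "num a \<in> {..<card A}" using lt E(1) by auto
      then show "x \<in> (\<lambda>j. (j, g j)) ` {..<card A}" using ab by (intro image_eqI) simp_all
    next
      fix x assume "x \<in> (\<lambda>j. (j, g j)) ` {..<card A}"
      then obtain j where j: "j < card A" "x = (j, g j)" by auto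
      then obtain e where e: "e \<in> E" "x = map_prod num num e" using g[OF j(1)] by auto
      then have "e \<in> S" using j(2) by (cases e) (auto simp: S_def)
      then show "x \<in> map_prod num num ` S" using e by blast
    qed
    show "deg_max A B S \<le> D"
      unfolding deg_max_def
    proof (rule Max.boundedI)
      fix x assume "x \<in> deg S ` (A \<union> B)"
      then consider a where "a \<in> A" "x = deg S a" | b where "b \<in> B" "x = deg S b" by blast
      then show "x \<le> D" using degA degB D(2) by cases simp_all
    qed (use E(3,4) \<open>A \<noteq> {}\<close> in auto)
  qed
qed

text \<open>Dividing the unmatched vertices by 3 in each of the \<open>L\<close> passes suffices only for \<open>L \<ge> 2\<close>; for
  \<open>L = 1\<close> we have \<open>n \<le> 3\<close>, and the trivial bound \<open>n\<close> on the degree is good enough.\<close>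

lemma least_complete_capacity:
  assumes L: "1 \<le> L" "2 ^ L \<le> n" "n < 2 ^ (L + 1)"
    and \<sigma>: "\<And>j. j < n \<Longrightarrow> (j, \<sigma> j) \<in> set es" "\<And>b. card {j. j < n \<and> \<sigma> j = b} \<le> d" "1 \<le> d"
    and r: "\<And>i. i < r \<Longrightarrow> \<exists>j<n. greedy_rounds n (2 ^ i) es L j = 0"
  shows "min (L * 2 ^ r) n \<le> 4 * L * d"
proof (cases "L = 1 \<or> r = 0")
  case True
  then show ?thesis
  proof
    assume "L = 1"
    then have "n \<le> 4 * L" using L(3) by simp
    also have "\<dots> \<le> 4 * L * d" using \<sigma>(3) by simp
    finally show ?thesis by simp
  next
    assume "r = 0"
    then have "L * 2 ^ r \<le> 4 * L * d" using \<sigma>(3) by simp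
    then show ?thesis by (rule min.coboundedI1)
  qed
next
  case False
  then obtain t where t: "r = Suc t" by (cases r) auto
  \<comment> \<open>\<open>2 ^ t\<close> is the last capacity before \<open>2 ^ r\<close>, hence one
    that failed, whereas capacities from \<open>2 * d\<close> on succeed.\<close>
  have "\<not> 2 * d \<le> 2 ^ t"
  proof
    assume "2 * d \<le> 2 ^ t"
    moreover have "L < n" using L(2) less_exp[of L] by linarith
    ultimately have *: "3 ^ L * card {j. j < n \<and> greedy_rounds n (2 ^ t) es L j = 0} \<le> n"
      using \<sigma> by (intro greedy_rounds_unmatched) auto
    \<comment> \<open>This yields \<open>n < 3 ^ L\<close>, so no vertex stays unmatched. The
      inequality begins at \<open>L = 2\<close> with \<open>8 \<le> 9\<close>.\<close>
    have "(2::nat) ^ (L + 1) \<le> 3 ^ L"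
    proof -
      obtain k where k: "L = k + 2" using False L(1) by (metis One_nat_def Suc_1 add.commute le_Suc_ex le_antisym not_less_eq_eq)
      have "(2::nat) ^ (L + 1) = 2 ^ k * 8" by (simp add: k)
      also have "\<dots> \<le> 3 ^ k * 9" by (intro mult_mono power_mono) auto
      finally show ?thesis by (simp add: k)
    qed
    then have "3 ^ L * card {j. j < n \<and> greedy_rounds n (2 ^ t) es L j = 0} < 3 ^ L * 1"
      using * L(3) by linarith
    then have "card {j. j < n \<and> greedy_rounds n (2 ^ t) es L j = 0} < 1"
      by (subst (asm) mult_less_cancel1) simp
    then show False using r[of t] t by auto
  qed
  then have "2 ^ r \<le> 4 * d" by (simp add: t)
  then have "L * 2 ^ r \<le> L * (4 * d)" by (rule mult_le_mono2)
  also have "\<dots> = 4 * L * d" by simp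
  finally show ?thesis by (rule min.coboundedI1)
qed

section \<open>Word size and space\<close>

text \<open>Codes stay below \<open>(n + m) * n\<close>, which is at most
  \<open>(c + 1) * n ^ (d + 2)\<close>. In \<open>w\<close>, the summand
  \<open>(d + 2) * (L + 1)\<close> pays for the power of \<open>n\<close> and \<open>c + 6\<close>
  for the constant factors.\<close>

lemma memory_bounds:
  fixes n L m c d K :: nat
  assumes L: "1 \<le> L" "2 ^ L \<le> n" "n < 2 ^ (L + 1)" and "K \<le> L + 2" "m \<le> c * n ^ d"
  defines "N \<equiv> 8 + K * n" and "w \<equiv> (d + 2) * (L + 1) + c + 6"
  shows "N + 4 * n < 2 ^ w" "(n + m) * n < 2 ^ w" "N * w \<le> 7 * (2 * d + c + 10) * n * L ^ 2"
proof -
  have n: "2 \<le> n" using L power_increasing[of 1 L "2::nat"] by simp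
  have Ln: "L < n" using L(2) less_exp[of L] by linarith
  have X: "n ^ (d + 2) \<le> 2 ^ ((d + 2) * (L + 1))"
    using power_mono[of n "2 ^ (L + 1)" "d + 2"] L(3) by (simp only: power_mult[symmetric] mult.commute)
  have c: "64 * (c + 1) \<le> 2 ^ (c + 6)" 
  proof -
    have "c + 1 \<le> 2 ^ c" using less_exp[of c] by linarith
    then show ?thesis unfolding power_add by simp
  qed
  have "n ^ (d + 2) * (64 * (c + 1)) \<le> 2 ^ ((d + 2) * (L + 1)) * 2 ^ (c + 6)"
    using X c by (rule mult_le_mono)
  also have "\<dots> = 2 ^ w" by (simp only: w_def power_add[symmetric] add.assoc)
  finally have W: "n ^ (d + 2) * (64 * (c + 1)) \<le> 2 ^ w" .
  have nn: "n * n \<le> n ^ (d + 2)" "0 < n * n" using n by (simp_all add: power_add power2_eq_square)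
  have "K * n \<le> (n + 1) * n" using assms(4) Ln by (intro mult_le_mono1) simp
  then have "K * n \<le> n * n + n" by simp
  moreover have "2 * n \<le> n * n" using n by (rule mult_le_mono1)
  ultimately have "N + 4 * n \<le> 6 * (n * n)" unfolding N_def using n by linarith
  also have "\<dots> < 64 * (n * n)" using nn(2) by simp
  also have "\<dots> \<le> n ^ (d + 2) * (64 * (c + 1))"
    using mult_le_mono[OF nn(1), of 64 "64 * (c + 1)"] by (simp add: mult.commute)
  also note W
  finally show "N + 4 * n < 2 ^ w" .
  have "m * n \<le> c * n ^ d * n" using assms(5) by (rule mult_le_mono1)
  also have "\<dots> \<le> c * n ^ d * n * n" using n by simp
  also have "\<dots> = n ^ (d + 2) * c" by (simp add: power_add power2_eq_square)
  finally have "(n + m) * n \<le> n ^ (d + 2) * (c + 1)"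
    using nn(1) unfolding add_mult_distrib add_mult_distrib2 by linarith
  also have "\<dots> < n ^ (d + 2) * (64 * (c + 1))" using n by (intro mult_less_mono2) auto
  also note W
  finally show "(n + m) * n < 2 ^ w" .
  have "K * n \<le> (3 * L) * n" using assms(4) L(1) by (intro mult_le_mono1) simp
  also have "\<dots> = 3 * (n * L)" by simp
  finally have "K * n \<le> 3 * (n * L)" .
  moreover have "2 * 1 \<le> n * L" using n L(1) by (rule mult_le_mono)
  \<comment> \<open>The blocks take \<open>3 * (n * L)\<close> cells, and the 8 registers at most
    \<open>4 * (n * L)\<close> because \<open>n * L \<ge> 2\<close>.\<close>
  ultimately have N: "N \<le> 7 * (n * L)" unfolding N_def by linarith
  have "(d + 2) * (L + 1) \<le> (d + 2) * (2 * L)" using L(1) by (intro mult_le_mono2) simp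
  moreover have "(c + 6) * 1 \<le> (c + 6) * L" using L(1) by (rule mult_le_mono2)
  ultimately have "(d + 2) * (L + 1) + (c + 6) * 1 \<le> (d + 2) * (2 * L) + (c + 6) * L"
    by (rule add_mono)
  also have "\<dots> = (2 * d + c + 10) * L" by (simp add: algebra_simps)
  finally have "w \<le> (2 * d + c + 10) * L" by (simp add: w_def)
  with N have "N * w \<le> 7 * (n * L) * ((2 * d + c + 10) * L)" by (rule mult_le_mono)
  then show "N * w \<le> 7 * (2 * d + c + 10) * n * L ^ 2"
    by (simp add: power2_eq_square algebra_simps)
qed

section \<open>Assembling the algorithm's guarantee\<close>

text \<open>The capacity index \<open>r\<close> is determined by the success of the greedy passes
  alone. A competitor \<open>S'\<close> enters only afterwards, in the estimate of
  \<open>2 ^ r\<close>, so one output serves for all of them.\<close>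

lemma greedy_alg_correct:
  fixes A B :: "'v set"
  assumes G: "bipartite_graph A B E" and n: "n = card A" "2 \<le> n"
    and m: "card B \<le> c * n ^ d"
    and ex: "\<exists>S. semi_matching A E S" and num: "numbering A B num" and es: "set es = E"
  shows "\<exists>N w S.
        real (N * w) \<le> real (7 * (2 * d + c + 10)) * real n * log 2 (real n) ^ 2 \<and>
        streaming_run N w greedy_alg (nat \<lfloor>log 2 (real n)\<rfloor>) n
          (map (map_prod num num) es) (map_prod num num ` S) \<and>
        semi_matching A E S \<and>
        (\<forall>S'. semi_matching A E S' \<longrightarrow>
           real (deg_max A B S) \<le> 4 * log 2 (real n) * real (deg_max A B S'))"
proof -
  define L where "L = nat \<lfloor>log 2 (real n)\<rfloor>"
  note L = floor_log_bounds[OF n(2), folded L_def]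
  have Ln: "L < n" using L(2) less_exp[of L] by linarith
  define es' where "es' = map (map_prod num num) es"
  have set_es': "set es' = map_prod num num ` E" by (simp add: es'_def es)
  define K where "K = (LEAST i. 2 * n \<le> 2 ^ i)"
  have "2 * n \<le> 2 ^ (L + 2)" using L(3) by simp
  then have K1: "2 * n \<le> 2 ^ K" "K \<le> L + 2"
    unfolding K_def by (rule LeastI, rule Least_le)
  have K: "2 ^ i < 2 * n \<longleftrightarrow> i < K" for i
  proof
    assume "2 ^ i < 2 * n"
    then have "(2::nat) ^ i < 2 ^ K" using K1(1) by linarith
    then show "i < K" by simp
  next
    assume "i < K"
    then show "2 ^ i < 2 * n" unfolding K_def using not_less_Least by force
  qed
  define N where "N = 8 + K * n"
  define w where "w = (d + 2) * (L + 1) + c + 6"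
  note mem = memory_bounds[OF L(1-3) K1(2) m, folded N_def w_def]
  interpret mach: machine n K N w
    using n(2) K mem(1) by unfold_locales (auto simp: N_def)
  let ?f = "\<lambda>i. greedy_rounds n (2 ^ i) es' L"
  have "0 < K" using K[of 0] n(2) by simp
  then obtain k where k: "K = Suc k" by (cases K) auto
  obtain \<sigma>0 where \<sigma>0: "\<And>j. j < n \<Longrightarrow> (j, \<sigma>0 j) \<in> set es'"
    using ex semi_matching_numbered[OF G num] unfolding n(1) set_es' by metis
  \<comment> \<open>From \<open>2 * 2 ^ k = 2 ^ K \<ge> 2 * n\<close> the last block has capacity at
    least \<open>n\<close>, so a complete block exists and \<open>r\<close> below is well
    defined.\<close>
  have complete: "\<forall>j<n. ?f k j \<noteq> 0"
  proof (intro allI impI)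
    fix j assume "j < n"
    then show "?f k j \<noteq> 0"
      using K1(1) k L(1) by (intro greedy_rounds_complete[OF _ _ \<sigma>0]) auto
  qed
  define r where "r = (LEAST i. \<forall>j<n. ?f i j \<noteq> 0)"
  have r: "?f r j \<noteq> 0" if "j < n" for j
    using LeastI[of "\<lambda>i. \<forall>j<n. ?f i j \<noteq> 0", OF complete] that by (simp add: r_def)
  have "r \<le> k" unfolding r_def by (rule Least_le) (rule complete)
  then have rK: "r < K" using k by simp
  have below: "\<exists>j<n. ?f i j = 0" if "i < r" for i
    using not_less_Least[of i "\<lambda>i. \<forall>j<n. ?f i j \<noteq> 0"] that by (auto simp: r_def)
  have verts: "a < n \<and> b * n + L < 2 ^ w" if "(a, b) \<in> set es'" for a b
  proof -
    obtain x y where "(x, y) \<in> E" and xy: "a = num x" "b = num y"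
      using \<open>(a, b) \<in> set es'\<close> unfolding set_es' by auto
    then have "x \<in> A" "y \<in> B" using G by (auto simp: bipartite_graph_def)
    then have "num x \<in> {..<card A}" "num y \<in> {card A..<card A + card B}"
      using num unfolding numbering_def bij_betw_def by blast+
    then have "a < n" "b < n + card B" by (simp_all add: xy n(1))
    then have "Suc b * n \<le> (n + card B) * n" by (intro mult_le_mono1) simp
    then show ?thesis using mem(2) Ln \<open>a < n\<close> by simp
  qed
  define g where "g j = ?f r j div n" for j
  have run: "streaming_run N w greedy_alg L n es' ((\<lambda>j. (j, g j)) ` {..<n})"
    unfolding g_def using verts Ln rK r below by (intro mach.streaming_run_greedy) (auto intro!: mach.n_less_word)
  have g_edge: "(j, g j) \<in> map_prod num num ` E" if "j < card A" for j
    using greedy_rounds_edge[OF r Ln, of j] that unfolding g_def set_es' n(1) by simp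
  have g_deg: "card {j. j < card A \<and> g j = b} \<le> min (L * 2 ^ r) n" for b
  \<comment> \<open>The trivial bound \<open>n\<close> is recorded as well, because the case of a
    single pass relies on it.\<close>
  proof (rule min.boundedI)
    show "card {j. j < card A \<and> g j = b} \<le> L * 2 ^ r"
      using greedy_rounds_degree[OF Ln r] unfolding g_def n(1) by simp
    have "card {j. j < card A \<and> g j = b} \<le> card {..<card A}" by (rule card_mono) auto
    then show "card {j. j < card A \<and> g j = b} \<le> n" using n(1) by simp
  qed
  have "A \<noteq> {}" using n by auto
  then obtain S where S: "semi_matching A E S" "map_prod num num ` S = (\<lambda>j. (j, g j)) ` {..<card A}"
    "deg_max A B S \<le> min (L * 2 ^ r) n"
    using numbered_semi_matching[OF G num _ g_edge g_deg] L(1) n(2) by auto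
  have opt: "real (deg_max A B S) \<le> 4 * log 2 (real n) * real (deg_max A B S')"
    if S': "semi_matching A E S'" for S'
  proof -
    obtain a where "a \<in> A" using \<open>A \<noteq> {}\<close> by blast
    then have pos: "1 \<le> deg_max A B S'"
      using deg_le_deg_max[OF G, of a S'] S' by (simp add: semi_matching_def)
    obtain \<sigma> where \<sigma>: "\<And>j. j < n \<Longrightarrow> (j, \<sigma> j) \<in> set es'"
      "\<And>b. card {j. j < n \<and> \<sigma> j = b} \<le> deg_max A B S'"
      using semi_matching_numbered[OF G num S'] unfolding n(1) set_es' by metis
    have "min (L * 2 ^ r) n \<le> 4 * L * deg_max A B S'"
      by (rule least_complete_capacity[OF L(1-3) _ _ pos]) (fact \<sigma> below)+
    then have "deg_max A B S \<le> 4 * L * deg_max A B S'" using S(3) by linarith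
    then have "real (deg_max A B S) \<le> real (4 * L * deg_max A B S')" by (simp only: of_nat_le_iff)
    also have "\<dots> = 4 * real L * real (deg_max A B S')" by simp
    also have "\<dots> \<le> 4 * log 2 (real n) * real (deg_max A B S')"
      using L(4) by (intro mult_right_mono) auto
    finally show ?thesis .
  qed
  have "real (N * w) \<le> real (7 * (2 * d + c + 10) * n * L ^ 2)" using mem(3) by (simp only: of_nat_le_iff)
  also have "\<dots> = real (7 * (2 * d + c + 10)) * real n * real L ^ 2" by simp
  also have "\<dots> \<le> real (7 * (2 * d + c + 10)) * real n * log 2 (real n) ^ 2"
    using L(4) by (intro mult_left_mono power_mono) auto
  finally have space: "real (N * w) \<le> real (7 * (2 * d + c + 10)) * real n * log 2 (real n) ^ 2" .
  have "streaming_run N w greedy_alg L n es' (map_prod num num ` S)"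
    using run by (simp only: S(2) n(1))
  with space S(1) opt show ?thesis unfolding L_def es'_def by blast
qed

theorem theorem2:
  fixes q :: "real poly"
  shows "\<exists>(P :: stream_alg) (C :: real) (k :: nat).
    \<forall>(A :: 'v set) B E num es (n :: nat).
      bipartite_graph A B E \<and> n = card A \<and> n \<ge> 2 \<and>
      real (card B) \<le> poly q (real n) \<and>
      (\<exists>S. semi_matching A E S) \<and>
      numbering A B num \<and> distinct es \<and> set es = E
      \<longrightarrow>
      (\<exists>N w S.
        real (N * w) \<le> C * real n * log 2 (real n) ^ k \<and>
        streaming_run N w P (nat \<lfloor>log 2 (real n)\<rfloor>) n
          (map (map_prod num num) es) (map_prod num num ` S) \<and>
        semi_matching A E S \<and>
        (\<forall>S'. optimal_semi_matching A E S' \<longrightarrow>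
           real (deg_max A B S) \<le> 4 * log 2 (real n) * real (deg_max A B S')))"
proof -
  obtain c d :: nat where q: "\<And>x. 1 \<le> x \<Longrightarrow> poly q x \<le> real c * x ^ d"
    using poly_le_monomial[of q] by blast
  show ?thesis
  \<comment> \<open>The exponent is 2: one logarithm for the number of capacity blocks and one for
    the word length.\<close>
  proof (rule exI[of _ greedy_alg], rule exI[of _ "real (7 * (2 * d + c + 10))"], rule exI[of _ 2],
      intro allI impI, elim conjE, goal_cases)
    case (1 A B E num es n)
    have "real (card B) \<le> real (c * n ^ d)" using 1 q[of "real n"] by simp
    then have m: "card B \<le> c * n ^ d" by (simp only: of_nat_le_iff)
    show ?case
      using greedy_alg_correct[OF 1(1-3) m 1(5,6,8)] unfolding optimal_semi_matching_def by blast
  qed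
qed

end
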